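(* Let $\phi_{2,h}\in\mathbb B^*_{\mathbf\Xi_2,p}$ and let the overlap width satisfy $d_o\le C\,h^\lambda$ with $C>0$, $\lambda\ge1$. There is a constant $c>0$, depending on $\rho$ but independent of $u$ and $\Omega_{o21}$, such that $$\|\phi_{2,h}\|^2_{L^2(\Omega_{o21})}\le c\,d_o\,h\Big(\int_{\Omega_2^*}|\nabla\phi_{2,h}|^2\,dx+\frac{\{\rho\}}{h}\int_{F_{o21}}\phi_{2,h}^2\,d\sigma\Big).$$
   Context: $\Omega\subset\mathbb R^d$, $d\in\{2,3\}$, is a bounded Lipschitz domain, $\overline\Omega=\overline{\Omega_1}\cup\overline{\Omega_2}$ with disjoint open subdomains $\Omega_1,\Omega_2$, interface $F_{12}=\partial\Omega_1\cap\partial\Omega_2$; the coefficient $\rho$ equals a constant $\rho_i>0$ on $\Omega_i$, and $\{\rho\}=\frac12(\rho_1+\rho_2)$. $u$ denotes the weak solution of $-\mathrm{div}(\rho\nabla u)=f$ in $\Omega$, $u=0$ on $\partial\Omega$. Overlapping patches: $\overline\Omega=\overline{\Omega_1^*}\cup\overline{\Omega_2^*}$ with $\Omega_{o21}=\Omega_1^*\cap\Omega_2^*\subset\Omega$, $F_{o12}=\partial\Omega_1^*\cap\Omega_2^*$, $F_{o21}=\partial\Omega_2^*\cap\Omega_1^*$, $\partial\Omega_{o21}=F_{o12}\cup F_{o21}$. Assumptions: $\Omega_1^*=\Omega_1$; $F_{o12}=F_{12}$ is a planar face with unit normal $n_{F_{o12}}$ exterior to $\Omega_1^*$; $F_{o21}$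 is a graph $z=\zeta_o(x,y)$, $0\le x\le x_M$, $0\le y\le y_M$, of a smooth function over $F_{o12}$ (analogously in 2d). With $\mathbf\Phi_{o12}:F_{o12}\to F_{o21}$, $\mathbf\Phi_{o12}(x)=x+\zeta_o(x)n_{F_{o12}}$ ($\zeta_o$ real-valued), the width is $d_o=\max_{x\in F_{o12}}|x-\mathbf\Phi_{o12}(x)|$. B-splines: $\hat{\mathbb B}_{\mathbf\Xi_2,p}$ is the tensor-product B-spline space of degree $p$ on $\widehat\Omega=(0,1)^d$ with open knot vectors $\mathbf\Xi_2$ (interior multiplicities at most $p$); $\mathbf\Phi_2^*:\widehat\Omega\to\Omega_2^*$ is a B-spline parametrization, sufficiently smooth, with $|\det J_{\mathbf\Phi_2^*}|$ bounded above and below by positive constants; $\mathbb B^*_{\mathbf\Xi_2,p}=\mathrm{span}\{\hat B_j\circ(\mathbf\Phi_2^* )^{-1}\}$. $h$ is the mesh size (maximum over the patches of the largest element diameter of the parametric meshes induced by the knots). *)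

theory Defs
  imports "HOL-Analysis.Analysis"
begin

definition grad :: "(real ^ 'n \<Rightarrow> real) \<Rightarrow> real ^ 'n \<Rightarrow> real ^ 'n" where
  "grad f x = (\<chi> i. frechet_derivative f (at x) (axis i 1))"

text \<open>To be used on open sets only.\<close>

primrec Ck_on :: "nat \<Rightarrow> (real ^ 'n) set \<Rightarrow> (real ^ 'n \<Rightarrow> real) \<Rightarrow> bool" where
  "Ck_on 0 U f \<longleftrightarrow> continuous_on U f"
| "Ck_on (Suc k) U f \<longleftrightarrow>
     (\<forall>x\<in>U. f differentiable (at x)) \<and> (\<forall>i. Ck_on k U (\<lambda>x. grad f x $ i))"

definition smooth_on :: "(real ^ 'n) set \<Rightarrow> (real ^ 'n \<Rightarrow> real) \<Rightarrow> bool" where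
  "smooth_on U f \<longleftrightarrow> (\<forall>k. Ck_on k U f)"

definition bounded_lipschitz_domain :: "(real ^ 'n) set \<Rightarrow> bool" where
  "bounded_lipschitz_domain D \<longleftrightarrow>
     open D \<and> connected D \<and> D \<noteq> {} \<and> bounded D \<and>
     (\<forall>x\<in>frontier D. \<exists>\<nu> g L r. norm \<nu> = 1 \<and> L-lipschitz_on UNIV (g :: real ^ 'n \<Rightarrow> real) \<and> 0 < r \<and>
        (\<forall>y\<in>ball x r. y \<in> D \<longleftrightarrow> g (y - (y \<bullet> \<nu>) *\<^sub>R \<nu>) < y \<bullet> \<nu>))"

definition subdomain :: "(real ^ 'n) set \<Rightarrow> (real ^ 'n) set \<Rightarrow> bool" where
  "subdomain D \<Omega> \<longleftrightarrow> open D \<and> connected D \<and> D \<noteq> {} \<and> D \<subseteq> \<Omega>"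

definition interface :: "(real ^ 'n) set \<Rightarrow> (real ^ 'n) set \<Rightarrow> (real ^ 'n) set" where
  "interface D1 D2 = frontier D1 \<inter> frontier D2"

definition L2_on :: "(real ^ 'n) set \<Rightarrow> (real ^ 'n \<Rightarrow> 'b::euclidean_space) \<Rightarrow> bool" where
  "L2_on D f \<longleftrightarrow> set_borel_measurable lebesgue D f \<and> set_integrable lebesgue D (\<lambda>x. (norm (f x))\<^sup>2)"

definition test_function :: "(real ^ 'n) set \<Rightarrow> (real ^ 'n \<Rightarrow> real) \<Rightarrow> bool" where
  "test_function D \<psi> \<longleftrightarrow>
     smooth_on UNIV \<psi> \<and> compact (closure {x. \<psi> x \<noteq> 0}) \<and> closure {x. \<psi> x \<noteq> 0} \<subseteq> D"

definition weak_gradient :: "(real ^ 'n) set \<Rightarrow> (real ^ 'n \<Rightarrow> real) \<Rightarrow> (real ^ 'n \<Rightarrow> real ^ 'n) \<Rightarrow> bool" where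
  "weak_gradient D u g \<longleftrightarrow>
     (\<forall>\<psi> i. test_function D \<psi> \<longrightarrow>
        (LINT x:D|lebesgue. u x * grad \<psi> x $ i) = - (LINT x:D|lebesgue. g x $ i * \<psi> x))"

text \<open>\<open>u\<close> belongs to \<open>H\<^sup>1\<^sub>0(D)\<close>, the closure of the test functions in the \<open>H\<^sup>1\<close> norm, and has
  weak gradient \<open>g\<close>.\<close>

definition H10_gradient :: "(real ^ 'n) set \<Rightarrow> (real ^ 'n \<Rightarrow> real) \<Rightarrow> (real ^ 'n \<Rightarrow> real ^ 'n) \<Rightarrow> bool" where
  "H10_gradient D u g \<longleftrightarrow>
     L2_on D u \<and> L2_on D g \<and> weak_gradient D u g \<and>
     (\<exists>\<psi>. (\<forall>k::nat. test_function D (\<psi> k)) \<and>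
        (\<lambda>k. (LINT x:D|lebesgue. (u x - \<psi> k x)\<^sup>2) +
             (LINT x:D|lebesgue. (norm (g x - grad (\<psi> k) x))\<^sup>2)) \<longlonglongrightarrow> 0)"

text \<open>Weak form of \<open>- div (\<rho> grad u) = f\<close> in \<open>D\<close>, \<open>u = 0\<close> on the boundary, with \<open>f\<close> in \<open>L\<^sup>2(D)\<close>.\<close>

definition weak_solution ::
  "(real ^ 'n) set \<Rightarrow> (real ^ 'n \<Rightarrow> real) \<Rightarrow> (real ^ 'n \<Rightarrow> real) \<Rightarrow> (real ^ 'n \<Rightarrow> real) \<Rightarrow> bool" where
  "weak_solution D \<rho> f u \<longleftrightarrow>
     L2_on D f \<and>
     (\<exists>g. H10_gradient D u g \<and>
        (\<forall>v gv. H10_gradient D v gv \<longrightarrow>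
           (LINT x:D|lebesgue. \<rho> x * (g x \<bullet> gv x)) = (LINT x:D|lebesgue. f x * v x)))"

text \<open>Cartesian coordinates on the hyperplane through \<open>a\<close> with unit normal \<open>n\<close>: the point with
  coordinates \<open>w\<close> is \<open>a + A w\<close>, where \<open>A\<close> is a linear isometry onto the orthogonal complement of \<open>n\<close>
  (for \<open>CARD('m) + 1 = CARD('n)\<close>).\<close>

definition face_chart :: "real ^ 'n \<Rightarrow> (real ^ 'm \<Rightarrow> real ^ 'n) \<Rightarrow> real ^ 'm \<Rightarrow> real ^ 'n" where
  "face_chart a A w = a + A w"

definition hyperplane_frame :: "(real ^ 'm \<Rightarrow> real ^ 'n) \<Rightarrow> real ^ 'n \<Rightarrow> bool" where
  "hyperplane_frame A n \<longleftrightarrow>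
     linear A \<and> (\<forall>w. norm (A w) = norm w) \<and> norm n = 1 \<and> (\<forall>w. n \<bullet> A w = 0)"

definition planar_face ::
  "(real ^ 'n) set \<Rightarrow> real ^ 'n \<Rightarrow> (real ^ 'm \<Rightarrow> real ^ 'n) \<Rightarrow> real ^ 'm \<Rightarrow> real ^ 'n \<Rightarrow> bool" where
  "planar_face F a A M n \<longleftrightarrow>
     hyperplane_frame A n \<and> (\<forall>i. 0 < M $ i) \<and> F = face_chart a A ` cbox 0 M"

definition exterior_normal :: "(real ^ 'n) set \<Rightarrow> (real ^ 'n) set \<Rightarrow> real ^ 'n \<Rightarrow> bool" where
  "exterior_normal D F n \<longleftrightarrow>
     (\<forall>x\<in>F. \<exists>e>0. \<forall>t. 0 < t \<and> t < e \<longrightarrow> x - t *\<^sub>R n \<in> D \<and> x + t *\<^sub>R n \<notin> D)"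

definition overlap_map :: "(real ^ 'n \<Rightarrow> real) \<Rightarrow> real ^ 'n \<Rightarrow> real ^ 'n \<Rightarrow> real ^ 'n" where
  "overlap_map \<zeta> n x = x + \<zeta> x *\<^sub>R n"

text \<open>\<open>overlap_face D1 D2\<close> is \<open>F\<^sub>o\<^sub>1\<^sub>2\<close> and \<open>overlap_face D2 D1\<close> is \<open>F\<^sub>o\<^sub>2\<^sub>1\<close>.\<close>

definition overlap_face :: "(real ^ 'n) set \<Rightarrow> (real ^ 'n) set \<Rightarrow> (real ^ 'n) set" where
  "overlap_face D1 D2 = frontier D1 \<inter> D2"

definition overlap_width :: "(real ^ 'n \<Rightarrow> real) \<Rightarrow> real ^ 'n \<Rightarrow> (real ^ 'n) set \<Rightarrow> real" where
  "overlap_width \<zeta> n F = (SUP x\<in>F. norm (x - overlap_map \<zeta> n x))"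

text \<open>\<open>F\<^sub>o\<^sub>1\<^sub>2\<close> and \<open>F\<^sub>o\<^sub>2\<^sub>1\<close> do not contain their edges, because the patches are open, whereas the interface
  and the boundary of the overlap are closed. The identities \<open>F\<^sub>o\<^sub>1\<^sub>2 = F\<^sub>1\<^sub>2\<close> and
  \<open>\<partial>\<Omega>\<^sub>o\<^sub>2\<^sub>1 = F\<^sub>o\<^sub>1\<^sub>2 \<union> F\<^sub>o\<^sub>2\<^sub>1\<close> are therefore taken up to edges. The height function \<open>\<zeta>\<close>
  is smooth up to the edges of the face.\<close>

definition overlapping_patches ::
  "(real ^ 'n) set \<Rightarrow> (real ^ 'n) set \<Rightarrow> (real ^ 'n) set \<Rightarrow> (real ^ 'n) set \<Rightarrow> (real ^ 'n) set \<Rightarrow>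
   real ^ 'n \<Rightarrow> (real ^ 'm \<Rightarrow> real ^ 'n) \<Rightarrow> real ^ 'm \<Rightarrow> real ^ 'n \<Rightarrow> (real ^ 'n \<Rightarrow> real) \<Rightarrow> bool" where
  "overlapping_patches \<Omega> \<Omega>1 \<Omega>2 D1 D2 a A M n \<zeta> \<longleftrightarrow>
     open D1 \<and> open D2 \<and> closure \<Omega> = closure D1 \<union> closure D2 \<and> D1 \<inter> D2 \<subseteq> \<Omega> \<and>
     D1 = \<Omega>1 \<and>
     overlap_face D1 D2 = rel_interior (interface \<Omega>1 \<Omega>2) \<and>
     exterior_normal D1 (overlap_face D1 D2) n \<and>
     (\<exists>U. open U \<and> cbox 0 M \<subseteq> U \<and> smooth_on U (\<zeta> \<circ> face_chart a A)) \<and>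
     overlap_face D2 D1 = overlap_map \<zeta> n ` overlap_face D1 D2 \<and>
     frontier (D1 \<inter> D2) = closure (overlap_face D1 D2 \<union> overlap_face D2 D1)"

text \<open>Surface integral of \<open>g\<close> over the graph of \<open>\<zeta>\<close> above the rectangle, with the surface element
  \<open>d\<sigma> = sqrt (1 + |grad \<zeta>|\<^sup>2) dw\<close> of a graph in Cartesian coordinates.\<close>

definition graph_surface_integral ::
  "real ^ 'n \<Rightarrow> (real ^ 'm \<Rightarrow> real ^ 'n) \<Rightarrow> real ^ 'm \<Rightarrow> real ^ 'n \<Rightarrow> (real ^ 'n \<Rightarrow> real) \<Rightarrow>
   (real ^ 'n \<Rightarrow> real) \<Rightarrow> real" where
  "graph_surface_integral a A M n \<zeta> g =
     (LINT w:box 0 M|lebesgue.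
        g (overlap_map \<zeta> n (face_chart a A w)) * sqrt (1 + (norm (grad (\<zeta> \<circ> face_chart a A) w))\<^sup>2))"

definition open_knot_vector :: "nat \<Rightarrow> real list \<Rightarrow> bool" where
  "open_knot_vector p \<xi> \<longleftrightarrow>
     sorted \<xi> \<and> set \<xi> \<subseteq> {0..1} \<and> count_list \<xi> 0 = p + 1 \<and> count_list \<xi> 1 = p + 1 \<and>
     (\<forall>t. 0 < t \<and> t < 1 \<longrightarrow> count_list \<xi> t \<le> p)"

text \<open>Cox-de Boor recursion with \<open>0 / 0 = 0\<close>. The last nonempty knot span is closed on the right, so that
  the functions are continuous from the left at the last knot.\<close>

fun bspline :: "real list \<Rightarrow> nat \<Rightarrow> nat \<Rightarrow> real \<Rightarrow> real" where
  "bspline \<xi> 0 i x =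
     (if \<xi> ! i \<le> x \<and> x < \<xi> ! (i + 1) \<or> \<xi> ! i < x \<and> x = \<xi> ! (i + 1) \<and> x = last \<xi> then 1 else 0)"
| "bspline \<xi> (Suc p) i x =
     (x - \<xi> ! i) / (\<xi> ! (i + p + 1) - \<xi> ! i) * bspline \<xi> p i x +
     (\<xi> ! (i + p + 2) - x) / (\<xi> ! (i + p + 2) - \<xi> ! (i + 1)) * bspline \<xi> p (i + 1) x"

definition bspline_indices :: "('n::finite \<Rightarrow> real list) \<Rightarrow> nat \<Rightarrow> ('n \<Rightarrow> nat) set" where
  "bspline_indices \<Xi> p = {j. \<forall>i. j i < length (\<Xi> i) - p - 1}"

definition tensor_bspline :: "('n::finite \<Rightarrow> real list) \<Rightarrow> nat \<Rightarrow> ('n \<Rightarrow> nat) \<Rightarrow> real ^ 'n \<Rightarrow> real" where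
  "tensor_bspline \<Xi> p j x = (\<Prod>i\<in>UNIV. bspline (\<Xi> i) p (j i) (x $ i))"

definition knot_spans :: "real list \<Rightarrow> (real \<times> real) set" where
  "knot_spans \<xi> = {(s, t). s \<in> set \<xi> \<and> t \<in> set \<xi> \<and> s < t \<and> {s<..<t} \<inter> set \<xi> = {}}"

definition parametric_mesh :: "('n::finite \<Rightarrow> real list) \<Rightarrow> (real ^ 'n) set set" where
  "parametric_mesh \<Xi> = {cbox a b |a b. \<forall>i. (a $ i, b $ i) \<in> knot_spans (\<Xi> i)}"

definition mesh_size :: "('n::finite \<Rightarrow> real list) \<Rightarrow> real" where
  "mesh_size \<Xi> = Max (diameter ` parametric_mesh \<Xi>)"

text \<open>The parametrization is a \<open>C\<^sup>1\<close> map on the closed unit cube which is injective there, so that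
  \<open>\<Phi>\<^sup>-\<^sup>1\<close>, and with it every function of the mapped spline space, is defined on the closure of the patch.
  \<open>P\<close> are the control points.\<close>

definition jacobian :: "(real ^ 'n \<Rightarrow> real ^ 'n) \<Rightarrow> real ^ 'n \<Rightarrow> real ^ 'n ^ 'n" where
  "jacobian \<Phi> x = matrix (frechet_derivative \<Phi> (at x within cbox 0 1))"

definition bspline_parametrization ::
  "('n::finite \<Rightarrow> real list) \<Rightarrow> nat \<Rightarrow> (real ^ 'n \<Rightarrow> real ^ 'n) \<Rightarrow> (real ^ 'n) set \<Rightarrow> bool" where
  "bspline_parametrization \<Xi> p \<Phi> D \<longleftrightarrow>
     (\<exists>P. \<forall>x\<in>cbox 0 1. \<Phi> x = (\<Sum>j\<in>bspline_indices \<Xi> p. tensor_bspline \<Xi> p j x *\<^sub>R P j)) \<and>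
     inj_on \<Phi> (cbox 0 1) \<and> \<Phi> ` box 0 1 = D \<and>
     (\<forall>x\<in>cbox 0 1. \<Phi> differentiable (at x within cbox 0 1)) \<and>
     continuous_on (cbox 0 1) (jacobian \<Phi>) \<and>
     (\<exists>m>0. \<exists>K>0. \<forall>x\<in>box 0 1. m \<le> \<bar>det (jacobian \<Phi> x)\<bar> \<and> \<bar>det (jacobian \<Phi> x)\<bar> \<le> K)"

definition mapped_bspline_space ::
  "('n::finite \<Rightarrow> real list) \<Rightarrow> nat \<Rightarrow> (real ^ 'n \<Rightarrow> real ^ 'n) \<Rightarrow> (real ^ 'n \<Rightarrow> real) set" where
  "mapped_bspline_space \<Xi> p \<Phi> =
     {\<lambda>x. \<Sum>j\<in>bspline_indices \<Xi> p. c j * tensor_bspline \<Xi> p j (inv_into (cbox 0 1) \<Phi> x) |c. True}"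

end

theory Submission
  imports Defs
begin

text \<open>In the coordinates \<open>x = a + A w + t n\<close> the overlap lies between the graphs \<open>t = 0\<close> and
  \<open>t = \<zeta>(w)\<close> over the face: its frontier is contained in the two graphs and it is bounded, so on each normal
  line it is either absent or the whole open segment between them. A mapped spline \<open>\<phi>\<close> is Lipschitz
  along segments in the patch and differentiable off the image of the knot hyperplanes, a compact null set. Hence
  on almost every normal line the fundamental theorem of calculus and the Cauchy-Schwarz inequality give
  \<open>\<phi>(w, t)\<^sup>2 \<le> 2 \<phi>(w, \<zeta>(w))\<^sup>2 + 2 d\<^sub>o \<integral> |grad \<phi>|\<^sup>2 dt\<close>. Integration over \<open>t\<close> and
  \<open>w\<close> yields the bound \<open>2 d\<^sub>o \<integral> \<phi>\<^sup>2 d\<sigma> + 2 d\<^sub>o\<^sup>2 \<integral> |grad \<phi>|\<^sup>2\<close>, and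
  \<open>d\<^sub>o \<le> C h\<^sup>\<lambda> \<le> C' h\<close> because \<open>h\<close> is at most the diameter of the unit cube.\<close>

subsection \<open>Lebesgue measure in hyperplane coordinates\<close>

text \<open>Since interior knots may have multiplicity \<open>p\<close>, a spline is continuous but
  in general not C1, and the patch need not be convex; hence \<open>\<phi>\<close> is Lipschitz only
  along segments in the patch. The exceptional set where it may fail to be differentiable can
  contain a piece of a normal line, so the one-dimensional argument is available on almost every
  line only, and the volume has to be split along the hyperplane coordinates. The Lipschitz constant
  depends on the parametrization and on the coefficients of \<open>\<phi>\<close>. It serves the
  fundamental theorem of calculus and integrability alone and never reaches the estimate. The slope
  of the graph disappears as well, because \<open>d\<sigma>\<close> dominates \<open>dw\<close>.
  Only the width remains, which is why the constant does not see the shape of the overlap. The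
  weight \<open>{\<rho>}\<close> merely rescales the boundary term and is compensated by a summand
  \<open>2 / {\<rho>}\<close> of the constant.\<close>

text \<open>The volume of a ball depends only on its radius and the dimension, and by Vitali's theorem a box is,
  up to a null set, a countable disjoint union of balls.\<close>

lemma lborel_distr_isometry:
  fixes f :: "'a::euclidean_space \<Rightarrow> 'b::euclidean_space"
  assumes dim: "DIM('a) = DIM('b)" and iso: "\<And>x y. dist (f x) (f y) = dist x y" and surj: "surj f"
  shows "distr lborel borel f = lborel"
proof (rule lborel_eqI[symmetric])
  let ?\<mu> = "distr lborel borel f"
  have inj: "inj f"
    by (metis iso dist_eq_0_iff injI)
  define g where "g = inv f"
  have fg: "f (g y) = y" and gf: "g (f x) = x" for x y
    using surj inj by (auto simp: g_def surj_f_inv_f)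
  have g_iso: "dist (g x) (g y) = dist x y" for x y
    by (metis iso fg)
  have "continuous_on UNIV f"
    unfolding continuous_on_iff iso by blast
  then have meas: "f \<in> borel_measurable borel"
    by (rule borel_measurable_continuous_onI)
  have vimage: "f -` X = g ` X" for X
    using fg gf by (auto simp: image_iff) metis
  have "f -` cball c r = cball (g c) r" for c r
    by (auto simp: fg iso) (metis fg iso)+
  then have cball: "emeasure ?\<mu> (cball c r) = emeasure lborel (cball c r)" if "0 \<le> r" for c r
    using that meas by (simp add: emeasure_distr emeasure_cball dim)
  fix l u :: 'b
  assume le: "\<And>b. b \<in> Basis \<Longrightarrow> l \<bullet> b \<le> u \<bullet> b"
  let ?U = "box l u"
  define K where "K = {(x, r). 0 < r \<and> cball x r \<subseteq> ?U}"
  have fine: "\<exists>i. i \<in> K \<and> x \<in> cball (fst i) (snd i) \<and> snd i < d" if "x \<in> ?U" "0 < d" for x d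
  proof -
    obtain e where e: "0 < e" "cball x e \<subseteq> ?U"
      using \<open>x \<in> ?U\<close> open_box open_contains_cball by blast
    define r where "r = min e (d / 2)"
    have r: "0 < r" "r < d" "r \<le> e"
      using e that by (auto simp: r_def)
    then have "(x, r) \<in> K"
      using e subset_cball[of r e x] by (auto simp: K_def)
    then show ?thesis
      using r by (intro exI[of _ "(x, r)"]) auto
  qed
  obtain C where C: "countable C" "C \<subseteq> K"
      "pairwise (\<lambda>i j. disjnt (cball (fst i) (snd i)) (cball (fst j) (snd j))) C"
      "negligible (?U - (\<Union>i\<in>C. cball (fst i) (snd i)))"
  proof (rule Vitali_covering_theorem_cballs[of K snd ?U fst, OF _ fine])
    show "0 < snd i" if "i \<in> K" for i
      using that by (auto simp: K_def)
  qed
  define V where "V = (\<Union>i\<in>C. cball (fst i) (snd i))"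
  have "cball (fst i) (snd i) \<subseteq> ?U" if "i \<in> C" for i
    using subsetD[OF C(2) that] by (cases i) (simp add: K_def)
  then have V: "V \<subseteq> ?U"
    unfolding V_def by blast
  have V_borel: "V \<in> sets borel"
    unfolding V_def using C(1) by (intro sets.countable_UN') auto
  \<comment> \<open>Preimages under \<open>f\<close> are images under \<open>g\<close>, and a
    Lipschitz map between spaces of equal dimension preserves null sets. So the part of the box
    missed by the balls is null for the pushed-forward measure too.\<close>
  have "negligible (g ` (?U - V))"
  proof (rule negligible_locally_Lipschitz_image)
    show "DIM('b) \<le> DIM('a)" "negligible (?U - V)"
      using dim C(4) by (auto simp: V_def)
    have "\<forall>y\<in>(?U - V) \<inter> UNIV. norm (g y - g x) \<le> 1 * norm (y - x)" for x
      by (simp add: dist_norm[symmetric] g_iso)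
    then show "\<exists>T B. open T \<and> x \<in> T \<and> (\<forall>y\<in>(?U - V) \<inter> T. norm (g y - g x) \<le> B * norm (y - x))" for x
      by (meson UNIV_I open_UNIV)
  qed
  moreover have "g ` (?U - V) \<in> sets borel"
    using measurable_sets[OF meas, of "?U - V"] V V_borel by (simp add: vimage)
  ultimately have null1: "?U - V \<in> null_sets ?\<mu>"
    using V V_borel meas by (auto simp: null_sets_def emeasure_distr vimage negligible_iff_null_sets)
  have null2: "?U - V \<in> null_sets lborel"
    using C(4) V V_borel by (auto simp: V_def[symmetric] negligible_iff_null_sets null_sets_def)
  have disj: "disjoint_family_on (\<lambda>i. cball (fst i) (snd i)) C"
    using C(3) by (auto simp: disjoint_family_on_def pairwise_def disjnt_def)
  have U: "?U = V \<union> (?U - V)"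
    using V V_borel by auto
  have "emeasure ?\<mu> ?U = emeasure ?\<mu> V"
    using null1 V V_borel by (subst U) (rule emeasure_Un_null_set; simp)
  also have "\<dots> = (\<integral>\<^sup>+i. emeasure ?\<mu> (cball (fst i) (snd i)) \<partial>count_space C)"
    unfolding V_def using C(1) disj by (intro emeasure_UN_countable) auto
  also have "\<dots> = (\<integral>\<^sup>+i. emeasure lborel (cball (fst i) (snd i)) \<partial>count_space C)"
    using C(2) by (intro nn_integral_cong cball) (auto simp: K_def)
  also have "\<dots> = emeasure lborel V"
    unfolding V_def using C(1) disj by (intro emeasure_UN_countable[symmetric]) auto
  also have "\<dots> = emeasure lborel ?U"
    using null2 V V_borel by (metis U emeasure_Un_null_set sets_lborel)
  finally show "emeasure ?\<mu> ?U = ennreal (\<Prod>b\<in>Basis. (u - l) \<bullet> b)"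
    using le by simp
qed simp

text \<open>Pythagoras for the splitting into the range of \<open>A\<close> and the line spanned by
  \<open>n\<close>. The isometry yields the change of variables below and also the uniqueness of the
  coordinates of a point.\<close>

lemma hyperplane_coordinates_dist:
  fixes A :: "real ^ 'm \<Rightarrow> real ^ 'n"
  assumes frame: "hyperplane_frame A n"
  shows "dist (a + A w + t *\<^sub>R n) (a + A v + s *\<^sub>R n) = dist (w, t) (v, s)"
proof -
  have lin: "linear A" and A: "\<And>w. norm (A w) = norm w" "norm n = 1" "\<And>w. n \<bullet> A w = 0"
    using frame by (auto simp: hyperplane_frame_def)
  have "(dist (a + A w + t *\<^sub>R n) (a + A v + s *\<^sub>R n))\<^sup>2 = (norm (A (w - v) + (t - s) *\<^sub>R n))\<^sup>2"
    by (simp add: dist_norm linear_diff[OF lin] algebra_simps)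
  also have "\<dots> = (norm (A (w - v)))\<^sup>2 + (t - s)\<^sup>2"
    using A(2) A(3)[of "w - v"] by (subst norm_add_Pythagorean) (auto simp: orthogonal_def inner_commute[of _ n])
  also have "\<dots> = (dist (w, t) (v, s))\<^sup>2"
    by (simp add: A dist_norm norm_Pair)
  finally show ?thesis
    by simp
qed

text \<open>Beyond the isometry, the point is surjectivity, which is a dimension count: an injective
  linear map from a space of dimension \<open>CARD('m) + 1\<close> into one of the same dimension is
  onto.\<close>

lemma lborel_distr_hyperplane_coordinates:
  fixes A :: "real ^ 'm \<Rightarrow> real ^ 'n"
  assumes frame: "hyperplane_frame A n" and card: "CARD('m) + 1 = CARD('n)"
  shows "distr (lborel \<Otimes>\<^sub>M lborel) borel (\<lambda>(w, t). a + A w + t *\<^sub>R n) = lborel"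
  unfolding lborel_prod
proof (rule lborel_distr_isometry)
  define T where "T = (\<lambda>(w, t). A w + t *\<^sub>R n)"
  have lin: "linear A"
    using frame by (auto simp: hyperplane_frame_def)
  show dim: "DIM((real ^ 'm) \<times> real) = DIM(real ^ 'n)"
    using card by simp
  show "dist (case x of (w, t) \<Rightarrow> a + A w + t *\<^sub>R n) (case y of (w, t) \<Rightarrow> a + A w + t *\<^sub>R n) = dist x y" for x y
    using hyperplane_coordinates_dist[OF frame] by (auto simp: case_prod_beta)
  have linT: "linear T"
    unfolding T_def case_prod_beta
    by (rule linearI) (auto simp: linear_add[OF lin] linear_scale[OF lin] algebra_simps)
  moreover have "inj T"
  proof (rule injI)
    fix x y assume "T x = T y"
    then have "dist x y = 0"
      using hyperplane_coordinates_dist[OF frame, of 0 "fst x" "snd x" "fst y" "snd y"]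
      by (simp add: T_def case_prod_beta)
    then show "x = y" by simp
  qed
  ultimately have "dim (range T) = DIM((real ^ 'm) \<times> real)"
    by (simp add: dim_image_eq)
  then have "span (range T) = UNIV"
    using dim dim_eq_full by metis
  then have "surj T"
    using linT by (metis linear_subspace_image span_eq_iff subspace_UNIV)
  then show "surj (\<lambda>(w, t). a + A w + t *\<^sub>R n)"
  proof -
    assume "surj T"
    have "\<exists>x. y = (case x of (w, t) \<Rightarrow> a + A w + t *\<^sub>R n)" for y
    proof -
      obtain x where "y - a = T x"
        using \<open>surj T\<close> by (rule surjE)
      then show ?thesis
        by (intro exI[of _ x]) (simp add: T_def case_prod_beta algebra_simps)
    qed
    then show ?thesis
      unfolding surj_def by blast
  qed
qed

lemma nn_integral_hyperplane_coordinates: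
  fixes A :: "real ^ 'm \<Rightarrow> real ^ 'n"
  assumes frame: "hyperplane_frame A n" and card: "CARD('m) + 1 = CARD('n)"
    and f: "f \<in> borel_measurable borel"
  shows "(\<integral>\<^sup>+x. f x \<partial>lborel) = (\<integral>\<^sup>+w. (\<integral>\<^sup>+t. f (a + A w + t *\<^sub>R n) \<partial>lborel) \<partial>lborel)"
proof -
  have lin: "linear A" using frame by (auto simp: hyperplane_frame_def)
  have T: "(\<lambda>(w, t). a + A w + t *\<^sub>R n) \<in> borel_measurable (lborel \<Otimes>\<^sub>M lborel)"
    unfolding lborel_prod case_prod_beta measurable_lborel2
    by (intro borel_measurable_continuous_onI continuous_intros linear_continuous_on_compose[OF _ lin])
  have "(\<integral>\<^sup>+x. f x \<partial>lborel) = (\<integral>\<^sup>+z. f (a + A (fst z) + snd z *\<^sub>R n) \<partial>(lborel \<Otimes>\<^sub>M lborel))"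
    by (subst lborel_distr_hyperplane_coordinates[OF frame card, of a, symmetric])
       (use f T in \<open>simp add: nn_integral_distr case_prod_beta\<close>)
  also have "\<dots> = (\<integral>\<^sup>+w. (\<integral>\<^sup>+t. f (a + A w + t *\<^sub>R n) \<partial>lborel) \<partial>lborel)"
    using measurable_compose[OF T f] by (subst lborel.nn_integral_fst[symmetric]) (auto simp: case_prod_beta)
  finally show ?thesis .
qed


subsection \<open>Lipschitz functions on an interval\<close>

text \<open>Dominated convergence for forward difference quotients: the Lipschitz constant dominates
  them, they converge to \<open>g'\<close> almost everywhere, and their integrals are explicit in
  terms of an antiderivative of \<open>g\<close>, whose own difference quotients tend to the values
  of \<open>g\<close> at the two ends.\<close>

lemma lipschitz_fundamental_theorem_AE:
  fixes g g' :: "real \<Rightarrow> real"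
  assumes ab: "a \<le> b" and lip: "L-lipschitz_on {a..b} g"
    and meas: "g' \<in> borel_measurable borel"
    and deriv: "AE x in lborel. x \<in> {a<..<b} \<longrightarrow> (g has_real_derivative g' x) (at x)"
  shows "integrable lborel (\<lambda>x. g' x * indicator {a..b} x)"
    and "(\<integral>x. g' x * indicator {a..b} x \<partial>lborel) = g b - g a"
proof -
  \<comment> \<open>Constant continuation outside \<open>{a..b}\<close> keeps the Lipschitz constant
    and makes the forward quotients near \<open>b\<close> meaningful.\<close>
  define e where "e x = g (max a (min b x))" for x
  have L: "0 \<le> L"
    using lip by (rule lipschitz_on_nonneg)
  have e_lip: "\<bar>e x - e y\<bar> \<le> L * \<bar>x - y\<bar>" for x y
  proof -
    have "\<bar>e x - e y\<bar> \<le> L * \<bar>max a (min b x) - max a (min b y)\<bar>"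
      using lipschitz_onD[OF lip, of "max a (min b x)" "max a (min b y)"] ab
      by (auto simp: e_def dist_real_def)
    also have "\<dots> \<le> L * \<bar>x - y\<bar>"
      using L by (intro mult_left_mono) (auto simp: max_def min_def)
    finally show ?thesis .
  qed
  have cont: "continuous_on UNIV e"
    by (rule lipschitz_on_continuous_on[of L]) (use e_lip L in \<open>auto simp: lipschitz_on_def dist_real_def\<close>)
  \<comment> \<open>The margins leave room for the shifts \<open>\<delta> k \<le> 1\<close>: for
    every \<open>x\<close> in \<open>{a..b}\<close> both \<open>x\<close> and
    \<open>x + \<delta> k\<close> are interior points.\<close>
  obtain F where F: "\<And>x. x \<in> {a-1..b+2} \<Longrightarrow> (F has_vector_derivative e x) (at x within {a-1..b+2})"
    using antiderivative_continuous[of "a-1" "b+2" e] continuous_on_subset[OF cont] by auto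
  have F': "(F has_real_derivative e x) (at x)" if "a \<le> x" "x \<le> b + 1" for x
  proof -
    have "(F has_vector_derivative e x) (at x within {a-1<..<b+2})"
      using that by (intro has_vector_derivative_within_subset[OF F]) auto
    then show ?thesis
      using that by (subst (asm) at_within_open) (auto simp: has_real_derivative_iff_has_vector_derivative)
  qed
  define \<delta> where "\<delta> k = inverse (real (Suc k))" for k
  have \<delta>: "0 < \<delta> k" "\<delta> k \<le> 1" for k
    by (auto simp: \<delta>_def field_simps)
  have \<delta>_at: "filterlim \<delta> (at 0) sequentially"
    using LIMSEQ_inverse_real_of_nat \<delta>(1) unfolding filterlim_at \<delta>_def
    by (auto simp: eventually_sequentially intro!: exI[of _ 0])
  define q where "q k x = (e (x + \<delta> k) - e x) / \<delta> k" for k x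
  have e_isCont: "isCont e x" for x
    using cont by (simp add: continuous_on_eq_continuous_at)
  have q_cont: "isCont (q k) x" for k x
  proof -
    have "isCont (\<lambda>x. e (x + \<delta> k)) x"
      by (rule isCont_o2[where g=e]) (auto intro: e_isCont)
    then show ?thesis
      unfolding q_def using \<delta>(1)[of k] by (intro continuous_intros e_isCont) auto
  qed
  have q_meas: "q k \<in> borel_measurable borel" for k
    using q_cont by (intro borel_measurable_continuous_onI) (simp add: continuous_on_eq_continuous_at)
  have q_bound: "\<bar>q k x\<bar> \<le> L" for k x
    using e_lip[of "x + \<delta> k" x] \<delta>(1)[of k] by (simp add: q_def field_simps)
  \<comment> \<open>The difference quotient of \<open>F\<close> with step \<open>\<delta> k\<close>
    is an antiderivative of \<open>q k\<close>, so the integral is the average of \<open>e\<close>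
    over a short interval at \<open>b\<close> minus that at \<open>a\<close>.\<close>
  have q_int: "(\<integral>x. q k x * indicator {a..b} x \<partial>lborel)
      = (F (b + \<delta> k) - F b) / \<delta> k - (F (a + \<delta> k) - F a) / \<delta> k" for k
  proof (subst integral_FTC_Icc_real[OF ab, where F="\<lambda>x. (F (x + \<delta> k) - F x) / \<delta> k"])
    fix x assume "a \<le> x" "x \<le> b"
    then have "((\<lambda>x. F (x + \<delta> k)) has_real_derivative e (x + \<delta> k)) (at x)" "(F has_real_derivative e x) (at x)"
      using \<delta>[of k] DERIV_shift[of F "e (x + \<delta> k)" x "\<delta> k"] by (auto intro!: F')
    then show "((\<lambda>x. (F (x + \<delta> k) - F x) / \<delta> k) has_real_derivative q k x) (at x)"
      unfolding q_def by (intro DERIV_cdivide DERIV_diff)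
  qed (auto simp: q_cont)
  have quot: "(\<lambda>k. (F (x + \<delta> k) - F x) / \<delta> k) \<longlonglongrightarrow> e x" if "a \<le> x" "x \<le> b" for x
    using F'[of x] that \<delta>_at unfolding DERIV_def
    by (auto intro: filterlim_compose)
  have lim1: "(\<lambda>k. \<integral>x. q k x * indicator {a..b} x \<partial>lborel) \<longlonglongrightarrow> e b - e a"
    unfolding q_int using ab by (intro tendsto_diff quot) auto
  have pointwise: "AE x in lborel. (\<lambda>k. q k x * indicator {a..b} x) \<longlonglongrightarrow> g' x * indicator {a..b} x"
    using deriv AE_lborel_singleton[of a] AE_lborel_singleton[of b]
  proof eventually_elim
    fix x assume x: "x \<in> {a<..<b} \<longrightarrow> (g has_real_derivative g' x) (at x)" "x \<noteq> a" "x \<noteq> b"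
    show "(\<lambda>k. q k x * indicator {a..b} x) \<longlonglongrightarrow> g' x * indicator {a..b} x"
    proof (cases "x \<in> {a<..<b}")
      case True
      have "(e has_real_derivative g' x) (at x)"
      proof (rule has_field_derivative_transform_within_open[of g])
        show "(g has_real_derivative g' x) (at x)" using x True by simp
        show "open {a<..<b}" "x \<in> {a<..<b}" using True by auto
      qed (auto simp: e_def)
      then have "(\<lambda>k. q k x) \<longlonglongrightarrow> g' x"
        using \<delta>_at unfolding DERIV_def q_def by (auto intro: filterlim_compose)
      then show ?thesis by (intro tendsto_intros)
    next
      case False
      then show ?thesis using x by (auto simp: indicator_def)
    qed
  qed
  have bound: "integrable lborel (\<lambda>x. L * indicator {a..b} x)"
    by (intro integrable_mult_right) (simp add: integrable_indicator_iff ab)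
  have norm: "AE x in lborel. norm (q k x * indicator {a..b} x) \<le> L * indicator {a..b} x" for k
    using q_bound L by (auto simp: abs_mult indicator_def)
  note dc = integrable_dominated_convergence integral_dominated_convergence
  have m1: "(\<lambda>x. g' x * indicator {a..b} x) \<in> borel_measurable lborel"
    using meas by measurable
  have m2: "(\<lambda>x. q k x * indicator {a..b} x) \<in> borel_measurable lborel" for k
    using q_meas by measurable
  show "integrable lborel (\<lambda>x. g' x * indicator {a..b} x)"
    by (rule dc(1)[OF m1 m2 bound pointwise norm])
  have "(\<lambda>k. \<integral>x. q k x * indicator {a..b} x \<partial>lborel) \<longlonglongrightarrow> (\<integral>x. g' x * indicator {a..b} x \<partial>lborel)"
    by (rule dc(2)[OF m1 m2 bound pointwise norm])
  from LIMSEQ_unique[OF this lim1] show "(\<integral>x. g' x * indicator {a..b} x \<partial>lborel) = g b - g a"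
    using ab by (simp add: e_def)
qed

text \<open>Cauchy-Schwarz against the indicator of \<open>{a..b}\<close>, whose square has integral
  \<open>b - a\<close>. The integral on the right runs over the whole line and may be infinite,
  since outside the interval \<open>g'\<close> is only measurable.\<close>

lemma lipschitz_increment_squared_le:
  fixes g g' :: "real \<Rightarrow> real"
  assumes ab: "a \<le> b" and lip: "L-lipschitz_on {a..b} g"
    and meas: "g' \<in> borel_measurable borel"
    and deriv: "AE x in lborel. x \<in> {a<..<b} \<longrightarrow> (g has_real_derivative g' x) (at x)"
  shows "ennreal ((g b - g a)\<^sup>2) \<le> ennreal (b - a) * (\<integral>\<^sup>+x. ennreal ((g' x)\<^sup>2) \<partial>lborel)"
proof -
  let ?I = "indicator {a..b} :: real \<Rightarrow> real"
  note ftc = lipschitz_fundamental_theorem_AE[OF assms]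
  have "ennreal \<bar>g b - g a\<bar> \<le> (\<integral>\<^sup>+x. ennreal \<bar>g' x * ?I x\<bar> \<partial>lborel)"
    using integral_norm_bound_ennreal[OF ftc(1)] by (simp add: ftc(2))
  also have "\<dots> = (\<integral>\<^sup>+x. ennreal \<bar>g' x\<bar> * indicator {a..b} x \<partial>lborel)"
    by (intro nn_integral_cong) (auto simp: indicator_def)
  finally have "ennreal ((g b - g a)\<^sup>2) \<le> (\<integral>\<^sup>+x. ennreal \<bar>g' x\<bar> * indicator {a..b} x \<partial>lborel)\<^sup>2"
    using power_mono[of "ennreal \<bar>g b - g a\<bar>" _ 2] by (simp add: ennreal_power)
  also have "\<dots> \<le> (\<integral>\<^sup>+x. ennreal \<bar>g' x\<bar> ^ 2 \<partial>lborel) * (\<integral>\<^sup>+x. indicator {a..b} x ^ 2 \<partial>lborel)"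
    using meas by (intro Cauchy_Schwarz_nn_integral) auto
  also have "(\<integral>\<^sup>+x. (indicator {a..b} x :: ennreal) ^ 2 \<partial>lborel) = (\<integral>\<^sup>+x. indicator {a..b} x \<partial>lborel)"
    by (intro nn_integral_cong) (auto simp: indicator_def)
  finally show ?thesis
    using ab by (simp add: ennreal_power mult.commute)
qed

subsection \<open>Continuity of B-splines\<close>

text \<open>The values of these functions are the left limits of the B-splines, which are continuous from the right.\<close>

fun bspline_left :: "real list \<Rightarrow> nat \<Rightarrow> nat \<Rightarrow> real \<Rightarrow> real" where
  "bspline_left \<xi> 0 i x = (if \<xi> ! i < x \<and> x \<le> \<xi> ! (i + 1) then 1 else 0)"
| "bspline_left \<xi> (Suc p) i x =
     (x - \<xi> ! i) / (\<xi> ! (i + p + 1) - \<xi> ! i) * bspline_left \<xi> p i x +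
     (\<xi> ! (i + p + 2) - x) / (\<xi> ! (i + p + 2) - \<xi> ! (i + 1)) * bspline_left \<xi> p (i + 1) x"

lemma bspline_left_tendsto: "(bspline_left \<xi> p i \<longlongrightarrow> bspline_left \<xi> p i x) (at_left x)"
proof (induction p arbitrary: i)
  case 0
  have "eventually (\<lambda>y. bspline_left \<xi> 0 i y = bspline_left \<xi> 0 i x) (at_left x)"
  proof -
    consider "x \<le> \<xi> ! i" | "\<xi> ! i < x" "x \<le> \<xi> ! (i + 1)" | "\<xi> ! i < x" "\<xi> ! (i + 1) < x" by linarith
    then show ?thesis
    proof cases
      case 1
      then show ?thesis
        by (intro eventually_at_leftI[of "x - 1"]) auto
    next
      case 2
      then show ?thesis
        by (intro eventually_at_leftI[of "\<xi> ! i"]) auto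
    next
      case 3
      then show ?thesis
        by (intro eventually_at_leftI[of "\<xi> ! (i + 1)"]) auto
    qed
  qed
  then show ?case
    by (rule tendsto_eventually)
next
  case (Suc p)
  \<comment> \<open>Quotients become products with a constant inverse, which covers coinciding
    knots: a zero denominator merely gives the factor 0.\<close>
  show ?case
    unfolding bspline_left.simps divide_inverse by (intro tendsto_intros Suc.IH)
qed

text \<open>The right-closed last span makes \<open>last \<xi>\<close> exceptional: a degree 0
  function that equals 1 there drops to 0 immediately to its right, hence the hypothesis.\<close>

lemma bspline_tendsto_right:
  assumes "x < last \<xi>"
  shows "(bspline \<xi> p i \<longlongrightarrow> bspline \<xi> p i x) (at_right x)"
proof (induction p arbitrary: i)
  case 0
  have "eventually (\<lambda>y. bspline \<xi> 0 i y = bspline \<xi> 0 i x) (at_right x)"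
  proof -
    consider "x < \<xi> ! i" | "\<xi> ! i \<le> x" "x < \<xi> ! (i + 1)" | "\<xi> ! i \<le> x" "\<xi> ! (i + 1) \<le> x" by linarith
    then show ?thesis
    proof cases
      case 1
      then show ?thesis
        by (intro eventually_at_rightI[of _ "\<xi> ! i"]) auto
    next
      case 2
      then show ?thesis
        by (intro eventually_at_rightI[of _ "\<xi> ! (i + 1)"]) auto
    next
      case 3
      then show ?thesis
        using assms by (intro eventually_at_rightI[of _ "last \<xi>"]) auto
    qed
  qed
  then show ?case
    by (rule tendsto_eventually)
next
  case (Suc p)
  show ?case
    unfolding bspline.simps divide_inverse by (intro tendsto_intros Suc.IH)
qed

lemma bspline_left_eq_off_knots:
  assumes "x \<notin> set \<xi>" "i + p + 1 < length \<xi>"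
  shows "bspline_left \<xi> p i x = bspline \<xi> p i x"
  using assms(2)
proof (induction p arbitrary: i)
  case 0
  then have "\<xi> ! i \<noteq> x" "\<xi> ! (i + 1) \<noteq> x"
    using assms(1) by (auto simp: in_set_conv_nth)
  then show ?case by auto
qed auto

text \<open>No knot exceeds \<open>last \<xi>\<close>, so at this point the right-closed convention
  makes the degree 0 functions coincide with their left-continuous versions; the common recursion
  does the rest.\<close>

lemma bspline_left_eq_last:
  assumes "i + p + 1 < length \<xi>" "sorted \<xi>"
  shows "bspline_left \<xi> p i (last \<xi>) = bspline \<xi> p i (last \<xi>)"
  using assms(1)
proof (induction p arbitrary: i)
  case 0
  then have "\<xi> ! (i + 1) \<le> last \<xi>"
    using assms(2) by (cases \<xi> rule: rev_cases) (auto simp: sorted_append nth_append)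
  then show ?case by auto
qed auto

text \<open>At a knot \<open>x\<close> of multiplicity \<open>m\<close>, occupying the positions \<open>s + 1, \<dots>, s + m\<close>, the two one-sided
  versions of degree \<open>p \<le> m\<close> are Kronecker deltas concentrated at \<open>s + m - p\<close> and \<open>s\<close>. They coincide for
  \<open>p = m\<close>, and the common recursion propagates the coincidence to all higher degrees.\<close>

lemma bspline_at_knot:
  assumes lt: "\<xi> ! s < x" and eq: "\<And>k. s < k \<Longrightarrow> k \<le> s + m \<Longrightarrow> \<xi> ! k = x" and gt: "x < \<xi> ! (s + m + 1)"
    and sorted: "sorted \<xi>" and len: "s + m + 1 < length \<xi>"
    and "p \<le> m" "i + p + 1 < length \<xi>"
  shows "bspline \<xi> p i x = (if i + p = s + m then 1 else 0)"
    and "bspline_left \<xi> p i x = (if i = s then 1 else 0)"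
proof -
  have below: "\<xi> ! k < x" if "k \<le> s" for k
    using sorted_nth_mono[OF sorted that] lt len by fastforce
  have above: "x < \<xi> ! k" if "s + m < k" "k < length \<xi>" for k
    using sorted_nth_mono[OF sorted, of "s + m + 1" k] that gt by fastforce
  have last: "x < last \<xi>"
    using len above[of "length \<xi> - 1"] by (subst last_conv_nth) auto
  have cmp: "\<xi> ! k \<le> x \<longleftrightarrow> k \<le> s + m" "\<xi> ! k < x \<longleftrightarrow> k \<le> s" if "k < length \<xi>" for k
    using below above eq that by (metis not_le order.asym order.irrefl)+
  show "bspline \<xi> p i x = (if i + p = s + m then 1 else 0)"
    using assms(6,7)
  proof (induction p arbitrary: i)
    case 0
    then show ?case
      using cmp(1)[of i] cmp(1)[of "i + 1"] last by (auto simp: not_le[symmetric])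
  next
    case (Suc p)
    then have IH: "bspline \<xi> p i x = (if i + p = s + m then 1 else 0)"
        "bspline \<xi> p (i + 1) x = (if i + 1 + p = s + m then 1 else 0)"
      by auto
    \<comment> \<open>The nonzero degree \<open>p\<close> function gets weight 0 in the first case,
      since \<open>\<xi> ! i = x\<close>, and weight 1 in the second, since
      \<open>\<xi> ! (i + 1) = x\<close>. The surviving index therefore moves down by one with each
      degree.\<close>
    consider "i + p = s + m" | "i + 1 + p = s + m" | "i + p \<noteq> s + m" "i + 1 + p \<noteq> s + m" by blast
    then show ?case
    proof cases
      case 1
      then have "\<xi> ! i = x" using Suc.prems by (intro eq) auto
      then show ?thesis using 1 IH by auto
    next
      case 2
      then have "\<xi> ! (i + 1) = x" "x < \<xi> ! (i + p + 2)"
        using Suc.prems by (auto intro!: eq above)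
      then show ?thesis using 2 IH by auto
    qed (use IH in auto)
  qed
  show "bspline_left \<xi> p i x = (if i = s then 1 else 0)"
    using assms(6,7)
  proof (induction p arbitrary: i)
    case 0
    then show ?case
      using cmp(2)[of i] cmp(2)[of "i + 1"] by (auto simp: not_less[symmetric])
  next
    case (Suc p)
    then have IH: "bspline_left \<xi> p i x = (if i = s then 1 else 0)"
        "bspline_left \<xi> p (i + 1) x = (if i + 1 = s then 1 else 0)"
      by auto
    \<comment> \<open>Here the weight is 1 in the first case and 0 in the second, both because
      \<open>\<xi> ! (s + p + 1) = x\<close>; the surviving index stays at \<open>s\<close>.\<close>
    consider "i = s" | "i + 1 = s" | "i \<noteq> s" "i + 1 \<noteq> s" by blast
    then show ?case
    proof cases
      case 1
      then have "\<xi> ! (i + p + 1) = x" "\<xi> ! i < x"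
        using Suc.prems lt by (auto intro!: eq)
      then show ?thesis using 1 IH by auto
    next
      case 2
      then have "\<xi> ! (i + p + 2) = x"
        using Suc.prems by (intro eq) auto
      then show ?thesis using 2 IH by auto
    qed (use IH in auto)
  qed
qed

lemma bspline_left_eq_at_knot:
  assumes lt: "\<xi> ! s < x" and eq: "\<And>k. s < k \<Longrightarrow> k \<le> s + m \<Longrightarrow> \<xi> ! k = x" and gt: "x < \<xi> ! (s + m + 1)"
    and sorted: "sorted \<xi>" and len: "s + m + 1 < length \<xi>"
    and "m \<le> p" "i + p + 1 < length \<xi>"
  shows "bspline_left \<xi> p i x = bspline \<xi> p i x"
  using assms(6,7)
proof (induction p arbitrary: i rule: dec_induct)
  case base
  then show ?case
    using bspline_at_knot[OF lt eq gt sorted len order_refl base] by auto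
next
  case (step p)
  then show ?case by simp
qed

text \<open>A sorted list is the concatenation of its entries below, equal to and above
  \<open>x\<close>, and \<open>s\<close> is the last position of the first part. The multiplicity
  may be 0: then the block is empty and \<open>x\<close> lies strictly inside a knot span, so knots
  and other points are treated alike.\<close>

lemma sorted_knot_block:
  fixes x :: real
  assumes sorted: "sorted \<xi>" and "hd \<xi> < x" "x < last \<xi>" "\<xi> \<noteq> []"
  obtains s where "\<xi> ! s < x" "\<And>k. s < k \<Longrightarrow> k \<le> s + count_list \<xi> x \<Longrightarrow> \<xi> ! k = x"
    "x < \<xi> ! (s + count_list \<xi> x + 1)" "s + count_list \<xi> x + 1 < length \<xi>"
proof -
  define as bs cs where "as = filter (\<lambda>y. y < x) \<xi>" and "bs = filter (\<lambda>y. y = x) \<xi>" and "cs = filter (\<lambda>y. x < y) \<xi>"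
  have "sorted ys \<Longrightarrow> ys = filter (\<lambda>y. y < x) ys @ filter (\<lambda>y. y = x) ys @ filter (\<lambda>y. x < y) ys" for ys :: "real list"
  proof (induction ys)
    case (Cons y ys)
    have "filter (\<lambda>z. z < x) ys = []" if "x \<le> y"
      using that Cons.prems by (auto simp: filter_empty_conv)
    moreover have "filter (\<lambda>z. z = x) ys = []" if "x < y"
      using that Cons.prems by (auto simp: filter_empty_conv)
    ultimately show ?case
      using Cons by (cases y x rule: linorder_cases) auto
  qed simp
  then have \<xi>: "\<xi> = as @ bs @ cs"
    using sorted by (simp add: as_def bs_def cs_def)
  have "as \<noteq> []" "cs \<noteq> []"
    using assms unfolding as_def cs_def filter_empty_conv by (auto dest: hd_in_set last_in_set)
  have bs: "bs = replicate (count_list \<xi> x) x"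
    unfolding bs_def by (induction \<xi>) auto
  define s where "s = length as - 1"
  have s: "Suc s = length as"
    using \<open>as \<noteq> []\<close> by (simp add: s_def)
  have len: "length bs = count_list \<xi> x" by (subst bs) simp
  show ?thesis
  proof
    have "\<xi> ! s = as ! s" by (subst \<xi>) (use s in \<open>simp add: nth_append\<close>)
    also have "as ! s \<in> set as" using s by simp
    finally show "\<xi> ! s < x" by (simp add: as_def)
    show "\<xi> ! k = x" if "s < k" "k \<le> s + count_list \<xi> x" for k
    proof -
      have "\<xi> ! k = bs ! (k - length as)"
        by (subst \<xi>) (use s that len in \<open>auto simp: nth_append\<close>)
      also have "\<dots> \<in> set bs" using s that len by (intro nth_mem) auto
      finally show ?thesis by (simp add: bs_def)
    qed
    have "\<xi> ! (s + count_list \<xi> x + 1) = cs ! 0"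
      by (subst \<xi>) (use s len in \<open>auto simp: nth_append\<close>)
    also have "cs ! 0 \<in> set cs" using \<open>cs \<noteq> []\<close> by simp
    finally show "x < \<xi> ! (s + count_list \<xi> x + 1)" by (simp add: cs_def)
    have "length \<xi> = length as + length bs + length cs" by (subst \<xi>) simp
    then show "s + count_list \<xi> x + 1 < length \<xi>"
      using s len \<open>cs \<noteq> []\<close> by (cases cs) auto
  qed
qed

lemma open_knot_vectorD:
  assumes "open_knot_vector p \<xi>"
  shows "sorted \<xi>" "set \<xi> \<subseteq> {0..1}" "0 \<in> set \<xi>" "1 \<in> set \<xi>" "\<xi> \<noteq> []" "hd \<xi> = 0" "last \<xi> = 1"
    "\<And>t. 0 < t \<Longrightarrow> t < 1 \<Longrightarrow> count_list \<xi> t \<le> p"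
proof -
  show s: "sorted \<xi>" "set \<xi> \<subseteq> {0..1}" "\<And>t. 0 < t \<Longrightarrow> t < 1 \<Longrightarrow> count_list \<xi> t \<le> p"
    using assms by (auto simp: open_knot_vector_def)
  show m: "0 \<in> set \<xi>" "1 \<in> set \<xi>"
    using assms by (auto simp: open_knot_vector_def) (metis count_list_0_iff nat.distinct(1))+
  then show ne: "\<xi> \<noteq> []" by auto
  have "hd \<xi> \<le> 0"
    using s(1) m(1) by (cases \<xi>) auto
  then show "hd \<xi> = 0"
    using s(2) ne by (metis atLeastAtMost_iff hd_in_set in_mono order_antisym)
  have "1 \<le> last \<xi>"
    using s(1) m(2) by (cases \<xi> rule: rev_cases) (auto simp: sorted_append)
  then show "last \<xi> = 1"
    using s(2) ne by (metis atLeastAtMost_iff last_in_set in_mono order_antisym)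
qed

text \<open>Off the finitely many knots the B-spline agrees with \<open>bspline_left\<close>, so the
  two have the same left limits. These are the correct values because interior knots have
  multiplicity at most \<open>p\<close> and the last knot obeys the closing convention.\<close>

lemma bspline_continuous_on:
  assumes \<xi>: "open_knot_vector p \<xi>" and i: "i + p + 1 < length \<xi>"
  shows "continuous_on {0..1} (bspline \<xi> p i)"
proof -
  note k = open_knot_vectorD[OF \<xi>]
  have left: "(bspline \<xi> p i \<longlongrightarrow> bspline \<xi> p i x) (at_left x)" if x: "0 < x" "x \<le> 1" for x
  proof -
    have "bspline_left \<xi> p i x = bspline \<xi> p i x"
    proof (cases "x = 1")
      case True
      then show ?thesis using bspline_left_eq_last[OF i k(1)] k(7) by simp
    next
      case False
      then have "hd \<xi> < x" "x < last \<xi>" and m: "count_list \<xi> x \<le> p"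
        using x k by auto
      then obtain s where "\<xi> ! s < x" "\<And>k. s < k \<Longrightarrow> k \<le> s + count_list \<xi> x \<Longrightarrow> \<xi> ! k = x"
          "x < \<xi> ! (s + count_list \<xi> x + 1)" "s + count_list \<xi> x + 1 < length \<xi>"
        using sorted_knot_block[OF k(1) _ _ k(5)] by blast
      then show ?thesis
        using bspline_left_eq_at_knot[OF _ _ _ k(1) _ m i] by blast
    qed
    moreover have "eventually (\<lambda>y. bspline_left \<xi> p i y = bspline \<xi> p i y) (at_left x)"
    proof -
      have "eventually (\<lambda>y. y \<notin> set \<xi>) (at x)"
        using islimpt_finite[of "set \<xi>" x] by (simp add: islimpt_iff_eventually)
      then have "eventually (\<lambda>y. y \<notin> set \<xi>) (at_left x)"
        by (rule filter_leD[OF at_le, rotated]) simp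
      then show ?thesis
        by eventually_elim (rule bspline_left_eq_off_knots[OF _ i])
    qed
    ultimately show ?thesis
      using bspline_left_tendsto[of \<xi> p i x] by (metis tendsto_cong)
  qed
  have right: "(bspline \<xi> p i \<longlongrightarrow> bspline \<xi> p i x) (at_right x)" if "x < 1" for x
    using that k by (intro bspline_tendsto_right) simp
  show ?thesis
    unfolding continuous_on_def
  proof
    fix x :: real assume x: "x \<in> {0..1}"
    consider "x = 0" | "x = 1" | "0 < x" "x < 1" using x by fastforce
    then show "(bspline \<xi> p i \<longlongrightarrow> bspline \<xi> p i x) (at x within {0..1})"
    proof cases
      case 1
      then show ?thesis using right[of 0] by (simp add: at_within_Icc_at_right)
    next
      case 2
      then show ?thesis using left[of 1] by (simp add: at_within_Icc_at_left)
    next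
      case 3
      then show ?thesis
        using left[of x] right[of x] filterlim_split_at[of "bspline \<xi> p i"] by (auto simp: at_within_Icc_at)
    qed
  qed
qed

section \<open>Derivative and Lipschitz bounds for univariate B-splines\<close>

lemma bounded_image_mult:
  fixes f g :: "'a \<Rightarrow> 'b::real_normed_algebra"
  assumes "bounded (f ` S)" "bounded (g ` S)"
  shows "bounded ((\<lambda>x. f x * g x) ` S)"
proof -
  obtain a b where "\<forall>x\<in>S. norm (f x) \<le> a" "\<forall>x\<in>S. norm (g x) \<le> b"
    using assms by (auto simp: bounded_iff)
  then have "norm (f x * g x) \<le> a * b" if "x \<in> S" for x
    using that by (intro order_trans[OF norm_mult_ineq] mult_mono) (auto intro: order_trans[OF norm_ge_zero])
  then show ?thesis
    by (auto simp: bounded_iff)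
qed

text \<open>Boundedness of the B-spline itself has to join the induction, since the product rule
  multiplies it by the derivative of the weight. The values of \<open>f'\<close> at the knots carry
  no meaning but are bounded as well.\<close>

lemma bspline_deriv_off_knots:
  assumes "i + p + 1 < length \<xi>"
  obtains f' where "\<And>x. x \<notin> set \<xi> \<Longrightarrow> (bspline \<xi> p i has_real_derivative f' x) (at x)"
    "bounded (f' ` {0..1})"
proof -
  have "\<exists>f'. (\<forall>x. x \<notin> set \<xi> \<longrightarrow> (bspline \<xi> p i has_real_derivative f' x) (at x)) \<and>
     bounded (f' ` {0..1}) \<and> bounded (bspline \<xi> p i ` {0..1})"
    using assms
  proof (induction p arbitrary: i)
    case 0
    have "(bspline \<xi> 0 i has_real_derivative 0) (at x)" if x: "x \<notin> set \<xi>" for x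
    proof -
      have "\<exists>S. open S \<and> x \<in> S \<and> (\<forall>y\<in>S. bspline \<xi> 0 i x = bspline \<xi> 0 i y)"
      proof -
        have "\<xi> ! i \<in> set \<xi>" "\<xi> ! (i + 1) \<in> set \<xi>" using 0 by auto
        then consider "x < \<xi> ! i" | "\<xi> ! i < x" "x < \<xi> ! (i + 1)" | "\<xi> ! i < x" "\<xi> ! (i + 1) < x"
          using x by (metis linorder_neqE)
        then show ?thesis
        proof cases
          case 1
          then show ?thesis by (intro exI[of _ "{..<\<xi> ! i}"]) auto
        next
          case 2
          then show ?thesis by (intro exI[of _ "{\<xi> ! i<..<\<xi> ! (i + 1)}"]) auto
        next
          case 3
          then show ?thesis by (intro exI[of _ "{\<xi> ! (i + 1)<..}"]) auto
        qed
      qed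
      then obtain S where "open S" "x \<in> S" "\<And>y. y \<in> S \<Longrightarrow> bspline \<xi> 0 i x = bspline \<xi> 0 i y"
        by blast
      then show ?thesis
        by (rule has_field_derivative_transform_within_open[OF DERIV_const])
    qed
    moreover have "bounded (bspline \<xi> 0 i ` {0..1})"
      by (rule bounded_subset[of "{0, 1}"]) auto
    moreover have "bounded ((\<lambda>_. 0::real) ` {0..1::real})"
      by (rule bounded_subset[of "{0}"]) auto
    ultimately show ?case
      by (intro exI[of _ "\<lambda>_. 0"]) blast
  next
    case (Suc p)
    from Suc.IH[of i] Suc.prems obtain f1 where f1:
      "\<And>x. x \<notin> set \<xi> \<Longrightarrow> (bspline \<xi> p i has_real_derivative f1 x) (at x)"
      "bounded (f1 ` {0..1})" "bounded (bspline \<xi> p i ` {0..1})" by auto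
    from Suc.IH[of "i + 1"] Suc.prems obtain f2 where f2:
      "\<And>x. x \<notin> set \<xi> \<Longrightarrow> (bspline \<xi> p (i + 1) has_real_derivative f2 x) (at x)"
      "bounded (f2 ` {0..1})" "bounded (bspline \<xi> p (i + 1) ` {0..1})" by auto
    define c1 where "c1 x = (x - \<xi> ! i) / (\<xi> ! (i + p + 1) - \<xi> ! i)" for x
    define c2 where "c2 x = (\<xi> ! (i + p + 2) - x) / (\<xi> ! (i + p + 2) - \<xi> ! (i + 1))" for x
    \<comment> \<open>For coinciding knots the weight and its derivative are both 0, by the
      convention for division by 0.\<close>
    define d1 where "d1 = 1 / (\<xi> ! (i + p + 1) - \<xi> ! i)"
    define d2 where "d2 = - 1 / (\<xi> ! (i + p + 2) - \<xi> ! (i + 1))"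
    have c: "(c1 has_real_derivative d1) (at x)" "(c2 has_real_derivative d2) (at x)" for x
    proof -
      have "((\<lambda>x. x - \<xi> ! i) has_real_derivative 1) (at x)" "((\<lambda>x. \<xi> ! (i + p + 2) - x) has_real_derivative -1) (at x)"
        by (auto intro!: derivative_eq_intros)
      then show "(c1 has_real_derivative d1) (at x)" "(c2 has_real_derivative d2) (at x)"
        unfolding c1_def c2_def d1_def d2_def by - (rule DERIV_cdivide, assumption)+
    qed
    have "continuous_on {0..1} c1" "continuous_on {0..1} c2"
      using c by (meson DERIV_continuous_on has_field_derivative_at_within)+
    then have "bounded (c1 ` {0..1})" "bounded (c2 ` {0..1})"
      by (auto intro: compact_imp_bounded compact_continuous_image)
    moreover have "bounded ((\<lambda>_. d1) ` {0..1::real})" "bounded ((\<lambda>_. d2) ` {0..1::real})"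
      by (auto intro: bounded_subset[of "{d1}"] bounded_subset[of "{d2}"])
    moreover have eq: "bspline \<xi> (Suc p) i = (\<lambda>x. c1 x * bspline \<xi> p i x + c2 x * bspline \<xi> p (i + 1) x)"
      by (simp add: fun_eq_iff c1_def c2_def)
    ultimately show ?case
      unfolding eq
      by (intro exI[of _ "\<lambda>x. (d1 * bspline \<xi> p i x + f1 x * c1 x) + (d2 * bspline \<xi> p (i + 1) x + f2 x * c2 x)"] conjI allI impI
          DERIV_add DERIV_mult c f1(1) f2(1) bounded_plus_comp bounded_image_mult f1(2,3) f2(2,3))
  qed
  then show ?thesis using that by blast
qed

lemma lipschitz_on_piecewise_deriv:
  fixes f f' :: "real \<Rightarrow> real"
  assumes "finite S" "continuous_on {a..b} f" "0 \<le> B"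
    and deriv: "\<And>x. x \<in> {a<..<b} - S \<Longrightarrow> (f has_real_derivative f' x) (at x)"
    and bound: "\<And>x. x \<in> {a<..<b} - S \<Longrightarrow> \<bar>f' x\<bar> \<le> B"
  shows "B-lipschitz_on {a..b} f"
proof (rule lipschitz_on_leI)
  fix x y assume xy: "x \<in> {a..b}" "y \<in> {a..b}" "x \<le> y"
  \<comment> \<open>Zero values at the exceptional points and at the ends extend the bound
    \<open>B\<close> to the whole interval, as the integral estimate requires.\<close>
  define g where "g z = (if z \<in> S \<union> {x, y} then 0 else f' z)" for z
  have "(g has_integral f y - f x) {x..y}"
  proof (rule fundamental_theorem_of_calculus_strong[of "S \<union> {x, y}"])
    show "continuous_on {x..y} f"
      using xy by (intro continuous_on_subset[OF assms(2)]) auto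
    show "(f has_vector_derivative g z) (at z)" if "z \<in> {x..y} - (S \<union> {x, y})" for z
      using that xy deriv[of z] by (auto simp: g_def has_real_derivative_iff_has_vector_derivative)
  qed (use assms xy in auto)
  then have "(g has_integral f y - f x) (cbox x y)"
    by simp
  then have "norm (f y - f x) \<le> B * measure lborel (cbox x y)"
  proof (rule has_integral_bound[OF \<open>0 \<le> B\<close>])
    show "norm (g z) \<le> B" if "z \<in> cbox x y" for z
      using that xy bound[of z] \<open>0 \<le> B\<close> by (auto simp: g_def)
  qed
  then show "dist (f x) (f y) \<le> B * dist x y"
    using xy by (simp add: dist_real_def)
qed fact

lemma bspline_lipschitz_on:
  assumes \<xi>: "open_knot_vector p \<xi>" and i: "i + p + 1 < length \<xi>"
  obtains B where "B-lipschitz_on {0..1} (bspline \<xi> p i)"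
proof -
  obtain f' where f': "\<And>x. x \<notin> set \<xi> \<Longrightarrow> (bspline \<xi> p i has_real_derivative f' x) (at x)" "bounded (f' ` {0..1})"
    using bspline_deriv_off_knots[OF i] by blast
  obtain B where B: "\<And>x. x \<in> {0..1} \<Longrightarrow> \<bar>f' x\<bar> \<le> B"
    using f'(2) unfolding bounded_iff real_norm_def by blast
  have "B-lipschitz_on {0..1} (bspline \<xi> p i)"
    using f'(1) B order_trans[OF abs_ge_zero B[of 0]] by (intro lipschitz_on_piecewise_deriv[of "set \<xi>"] bspline_continuous_on[OF assms]) auto
  then show ?thesis by (rule that)
qed

subsection \<open>Mapped splines\<close>

lemma lipschitz_on_mult_compact:
  fixes f g :: "'a::metric_space \<Rightarrow> real"
  assumes "compact S" "L-lipschitz_on S f" "M-lipschitz_on S g"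
  shows "\<exists>K. K-lipschitz_on S (\<lambda>x. f x * g x)"
proof -
  have "bounded (f ` S)" "bounded (g ` S)"
    using assms by (auto intro!: compact_imp_bounded compact_continuous_image lipschitz_on_continuous_on)
  then obtain a b where "\<forall>x\<in>S. norm (f x) \<le> a" "\<forall>x\<in>S. norm (g x) \<le> b"
    by (auto simp: bounded_iff)
  then have ab: "\<bar>f x\<bar> \<le> \<bar>a\<bar>" "\<bar>g x\<bar> \<le> \<bar>b\<bar>" if "x \<in> S" for x
    using that by force+
  note L = lipschitz_on_nonneg[OF assms(2)] and M = lipschitz_on_nonneg[OF assms(3)]
  have "(\<bar>a\<bar> * M + \<bar>b\<bar> * L)-lipschitz_on S (\<lambda>x. f x * g x)"
  proof (rule lipschitz_onI)
    fix x y assume xy: "x \<in> S" "y \<in> S"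
    have "\<bar>f x * g x - f y * g y\<bar> = \<bar>f x * (g x - g y) + g y * (f x - f y)\<bar>"
      by (simp add: algebra_simps)
    also have "\<dots> \<le> \<bar>f x\<bar> * \<bar>g x - g y\<bar> + \<bar>g y\<bar> * \<bar>f x - f y\<bar>"
      by (metis abs_mult abs_triangle_ineq)
    also have "\<dots> \<le> \<bar>a\<bar> * (M * dist x y) + \<bar>b\<bar> * (L * dist x y)"
      using ab xy lipschitz_onD[OF assms(2) xy] lipschitz_onD[OF assms(3) xy]
      by (intro add_mono mult_mono) (auto simp: dist_real_def)
    finally show "dist (f x * g x) (f y * g y) \<le> (\<bar>a\<bar> * M + \<bar>b\<bar> * L) * dist x y"
      by (simp add: dist_real_def algebra_simps)
  qed (use L M in simp)
  then show ?thesis ..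
qed

lemma finite_bspline_indices: "finite (bspline_indices \<Xi> p)"
proof -
  have "bspline_indices \<Xi> p = PiE UNIV (\<lambda>i. {..<length (\<Xi> i) - p - 1})"
    by (auto simp: bspline_indices_def PiE_def)
  then show ?thesis
    by (simp add: finite_PiE)
qed

lemma tensor_bspline_lipschitz_on:
  fixes \<Xi> :: "'n::finite \<Rightarrow> real list"
  assumes \<Xi>: "\<forall>i. open_knot_vector p (\<Xi> i)" and j: "j \<in> bspline_indices \<Xi> p"
  shows "\<exists>L. L-lipschitz_on (cbox 0 1) (tensor_bspline \<Xi> p j)"
proof -
  have "\<exists>L. L-lipschitz_on (cbox 0 1) (\<lambda>x::real ^ 'n. \<Prod>i\<in>I. bspline (\<Xi> i) p (j i) (x $ i))" if "finite I" for I
    using that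
  proof induction
    case empty
    show ?case by (auto intro!: exI[of _ 0] lipschitz_onI)
  next
    case (insert i I)
    have "j i + p + 1 < length (\<Xi> i)"
      using j by (auto simp: bspline_indices_def less_diff_conv dest: spec[of _ i])
    then obtain B where B: "B-lipschitz_on {0..1} (bspline (\<Xi> i) p (j i))"
      using bspline_lipschitz_on[OF \<Xi>[rule_format]] by blast
    have "(\<lambda>x::real ^ 'n. x $ i) ` cbox 0 1 \<subseteq> {0..1}"
      by (auto simp: mem_box_cart)
    then have "B-lipschitz_on ((\<lambda>x::real ^ 'n. x $ i) ` cbox 0 1) (bspline (\<Xi> i) p (j i))"
      using B lipschitz_on_subset by blast
    moreover have "1-lipschitz_on (cbox 0 1) (\<lambda>x::real ^ 'n. x $ i)"
      by (intro lipschitz_onI) (auto simp: dist_vec_nth_le)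
    ultimately have "(B * 1)-lipschitz_on (cbox 0 1) (\<lambda>x::real ^ 'n. bspline (\<Xi> i) p (j i) (x $ i))"
      by (intro lipschitz_on_compose2)
    then show ?case
      using insert lipschitz_on_mult_compact[OF compact_cbox] by auto
  qed
  then show ?thesis
    by (auto simp: tensor_bspline_def[abs_def])
qed

lemma spline_lipschitz_on:
  assumes \<Xi>: "\<forall>i. open_knot_vector p (\<Xi> i)"
  shows "\<exists>L. L-lipschitz_on (cbox 0 1) (\<lambda>x. \<Sum>j\<in>bspline_indices \<Xi> p. c j * tensor_bspline \<Xi> p j x)"
proof -
  have "\<exists>L. L-lipschitz_on (cbox 0 1) (\<lambda>x. \<Sum>j\<in>J. c j * tensor_bspline \<Xi> p j x)"
    if "finite J" "J \<subseteq> bspline_indices \<Xi> p" for J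
    using that
  proof induction
    case empty
    show ?case by (auto intro!: exI[of _ 0] lipschitz_onI)
  next
    case (insert j J)
    then obtain L M where "L-lipschitz_on (cbox 0 1) (\<lambda>x. \<Sum>j\<in>J. c j * tensor_bspline \<Xi> p j x)"
        "M-lipschitz_on (cbox 0 1) (tensor_bspline \<Xi> p j)"
      using tensor_bspline_lipschitz_on[OF \<Xi>, of j] by auto
    then have "(\<bar>c j\<bar> * M + L)-lipschitz_on (cbox 0 1) (\<lambda>x. c j * tensor_bspline \<Xi> p j x + (\<Sum>j\<in>J. c j * tensor_bspline \<Xi> p j x))"
      by (intro lipschitz_on_add lipschitz_on_cmult_real)
    then show ?case
      using insert by auto
  qed
  then show ?thesis
    using finite_bspline_indices by blast
qed

lemma spline_differentiable:
  fixes \<Xi> :: "'n::finite \<Rightarrow> real list"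
  assumes x: "\<And>i. x $ i \<notin> set (\<Xi> i)"
  shows "(\<lambda>x. \<Sum>j\<in>bspline_indices \<Xi> p. c j * tensor_bspline \<Xi> p j x) differentiable (at x)"
proof (intro differentiable_sum finite_bspline_indices ballI differentiable_mult differentiable_const)
  fix j assume j: "j \<in> bspline_indices \<Xi> p"
  have "(\<lambda>x. \<Prod>i\<in>I. bspline (\<Xi> i) p (j i) (x $ i)) differentiable (at x)" if "finite I" for I
    using that
  proof induction
    case (insert i I)
    have "j i + p + 1 < length (\<Xi> i)"
      using j by (auto simp: bspline_indices_def less_diff_conv dest: spec[of _ i])
    then obtain f' where "(bspline (\<Xi> i) p (j i) has_real_derivative f' (x $ i)) (at (x $ i))"
      using bspline_deriv_off_knots x[of i] by metis
    then have "((\<lambda>x. bspline (\<Xi> i) p (j i) (x $ i)) has_derivative (\<lambda>v. v $ i * f' (x $ i))) (at x)"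
      by (rule DERIV_compose_FDERIV) (rule bounded_linear_imp_has_derivative[OF bounded_linear_vec_nth])
    then show ?case
      using insert by (auto simp: differentiable_def intro!: differentiable_mult[unfolded differentiable_def])
  qed simp
  then show "tensor_bspline \<Xi> p j differentiable (at x)"
    by (simp add: tensor_bspline_def[abs_def])
qed

text \<open>Injectivity on the compact cube makes the inverse continuous, and a continuous inverse
  of a map with invertible derivative is differentiable on the open set \<open>D\<close>. The
  determinant bound passes from the open to the closed cube by continuity, where compactness turns
  pointwise invertibility into a derivative bound that is uniform up to the boundary of
  \<open>D\<close>.\<close>

lemma bspline_parametrization_inverse:
  fixes \<Phi> :: "real ^ 'n \<Rightarrow> real ^ 'n"
  assumes param: "bspline_parametrization \<Xi> p \<Phi> D" and D: "open D"
  defines "\<Psi> \<equiv> inv_into (cbox 0 1) \<Phi>"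
  shows "continuous_on (cbox 0 1) \<Phi>" "closure D \<subseteq> \<Phi> ` cbox 0 1" "continuous_on (\<Phi> ` cbox 0 1) \<Psi>"
    "\<And>x. x \<in> D \<Longrightarrow> \<Psi> x \<in> box 0 1"
    "\<exists>B. \<forall>x\<in>D. \<exists>\<Psi>'. (\<Psi> has_derivative \<Psi>') (at x) \<and> onorm \<Psi>' \<le> B"
proof -
  let ?Q = "cbox 0 1 :: (real ^ 'n) set"
  have inj: "inj_on \<Phi> ?Q" and img: "\<Phi> ` box 0 1 = D"
    and diff: "\<And>x. x \<in> ?Q \<Longrightarrow> \<Phi> differentiable (at x within ?Q)"
    and contJ: "continuous_on ?Q (jacobian \<Phi>)"
    using param by (auto simp: bspline_parametrization_def)
  obtain m where m: "0 < m" "\<And>x. x \<in> box 0 1 \<Longrightarrow> m \<le> \<bar>det (jacobian \<Phi> x)\<bar>"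
    using param unfolding bspline_parametrization_def by blast
  show cont: "continuous_on ?Q \<Phi>"
    using diff by (meson continuous_on_eq_continuous_within differentiable_imp_continuous_within)
  have box_sub: "box 0 1 \<subseteq> ?Q"
    by (rule box_subset_cbox)
  have "compact (\<Phi> ` ?Q)"
    by (intro compact_continuous_image cont compact_cbox)
  then show "closure D \<subseteq> \<Phi> ` ?Q"
    using img box_sub by (intro closure_minimal compact_imp_closed) auto
  show contI: "continuous_on (\<Phi> ` ?Q) \<Psi>"
    unfolding \<Psi>_def by (rule continuous_on_inv[OF cont compact_cbox]) (use inj in auto)
  show \<Psi>_box: "\<Psi> x \<in> box 0 1" if "x \<in> D" for x
  proof -
    obtain y where y: "y \<in> box 0 1" "x = \<Phi> y"
      using \<open>x \<in> D\<close> img by auto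
    then have "\<Psi> x = y"
      unfolding \<Psi>_def using inj box_sub by (simp add: subsetD)
    then show ?thesis using y by simp
  qed
  have \<Phi>\<Psi>: "\<Phi> (\<Psi> x) = x" if "x \<in> D" for x
    unfolding \<Psi>_def using that img box_sub by (intro f_inv_into_f) auto

  have contdet: "continuous_on ?Q (\<lambda>x. det (jacobian \<Phi> x))"
    unfolding det_def by (intro continuous_intros continuous_on_component contJ)
  have "closed {x \<in> ?Q. m \<le> \<bar>det (jacobian \<Phi> x)\<bar>}"
    using continuous_closed_preimage[OF continuous_on_rabs[OF contdet], of "{m..}"]
    by (simp add: vimage_def Int_def closed_cbox)
  then have "closure (box 0 1) \<subseteq> {x \<in> ?Q. m \<le> \<bar>det (jacobian \<Phi> x)\<bar>}"
    using m(2) box_sub by (intro closure_minimal) auto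
  moreover have ne: "box 0 1 \<noteq> ({} :: (real ^ 'n) set)"
    by (auto simp: box_ne_empty Basis_vec_def inner_axis)
  ultimately have det: "det (jacobian \<Phi> x) \<noteq> 0" if "x \<in> ?Q" for x
    using that m(1) by (auto simp: closure_box)
  \<comment> \<open>The minimum of \<open>H\<close> over the cube times the unit sphere bounds the
    stretching by all Jacobians from below; its reciprocal bounds the norms of their
    inverses.\<close>
  define H where "H z = norm (jacobian \<Phi> (fst z) *v snd z)" for z :: "(real ^ 'n) \<times> (real ^ 'n)"
  have contH: "continuous_on (?Q \<times> sphere 0 1) H"
    unfolding H_def matrix_vector_mult_def
    by (intro continuous_intros continuous_on_component continuous_on_compose2[OF contJ]) auto
  have "compact (?Q \<times> sphere (0::real ^ 'n) 1)" "?Q \<times> sphere (0::real ^ 'n) 1 \<noteq> {}"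
    using ne box_sub by (auto intro: compact_Times)
  then obtain z where z: "z \<in> ?Q \<times> sphere 0 1" "\<And>y. y \<in> ?Q \<times> sphere 0 1 \<Longrightarrow> H z \<le> H y"
    using continuous_attains_inf[OF _ _ contH] by blast
  define \<kappa> where "\<kappa> = H z"
  have "jacobian \<Phi> (fst z) *v snd z \<noteq> 0"
  proof
    assume "jacobian \<Phi> (fst z) *v snd z = 0"
    moreover have "invertible (jacobian \<Phi> (fst z))"
      using det[of "fst z"] z(1) by (auto simp: invertible_det_nz)
    ultimately have "snd z = 0"
      by (metis matrix_left_invertible_ker invertible_left_inverse)
    then show False using z(1) by auto
  qed
  then have \<kappa>: "0 < \<kappa>"
    by (simp add: \<kappa>_def H_def)
  have expand: "\<kappa> * norm v \<le> norm (jacobian \<Phi> x *v v)" if x: "x \<in> ?Q" for x v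
  proof (cases "v = 0")
    case False
    then have "\<kappa> \<le> norm (jacobian \<Phi> x *v (v /\<^sub>R norm v))"
      using z(2)[of "(x, v /\<^sub>R norm v)"] x by (simp add: \<kappa>_def H_def)
    also have "\<dots> = norm (jacobian \<Phi> x *v v) / norm v"
      by (simp add: matrix_vector_mult_scaleR divide_inverse_commute)
    finally show ?thesis
      using False by (simp add: field_simps)
  qed simp
  have "\<exists>\<Psi>'. (\<Psi> has_derivative \<Psi>') (at x) \<and> onorm \<Psi>' \<le> 1 / \<kappa>" if x: "x \<in> D" for x
  proof (intro exI conjI)
    let ?y = "\<Psi> x" and ?J = "jacobian \<Phi> (\<Psi> x)"
    have y: "?y \<in> box 0 1" "?y \<in> ?Q"
      using \<Psi>_box[OF x] box_sub by auto
    \<comment> \<open>\<open>jacobian\<close> is built from derivatives within the closed cube; at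
      an interior point these are unrestricted derivatives.\<close>
    have "(\<Phi> has_derivative frechet_derivative \<Phi> (at ?y within ?Q)) (at ?y within ?Q)"
      using diff[OF y(2)] by (simp only: frechet_derivative_works)
    then have "(\<Phi> has_derivative frechet_derivative \<Phi> (at ?y within ?Q)) (at ?y)"
      using y(1) by (simp only: at_within_interior interior_cbox)
    moreover from this have "(*v) ?J = frechet_derivative \<Phi> (at ?y within ?Q)"
      unfolding jacobian_def by (rule matrix_vector_mul(2)[OF has_derivative_linear])
    ultimately have der: "(\<Phi> has_derivative (*v) ?J) (at ?y)"
      by simp
    have inv: "invertible ?J"
      using det[OF y(2)] by (simp add: invertible_det_nz)
    have J1: "matrix_inv ?J ** ?J = mat 1" "?J ** matrix_inv ?J = mat 1"
      using someI_ex[OF inv[unfolded invertible_def]] unfolding matrix_inv_def by blast+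
    show "(\<Psi> has_derivative (*v) (matrix_inv ?J)) (at x)"
    proof (rule has_derivative_inverse_basic[OF der _ _ _ D x \<Phi>\<Psi>])
      show "bounded_linear ((*v) (matrix_inv ?J))"
        by (rule matrix_vector_mul_bounded_linear)
      show "(*v) (matrix_inv ?J) \<circ> (*v) ?J = id"
        by (auto simp: fun_eq_iff matrix_vector_mul_assoc J1)
      have "continuous_on D \<Psi>"
        using contI img box_sub by (rule_tac continuous_on_subset) auto
      then show "continuous (at x) \<Psi>"
        using D x by (simp add: continuous_on_eq_continuous_at)
    qed
    show "onorm ((*v) (matrix_inv ?J)) \<le> 1 / \<kappa>"
    proof (rule onorm_le)
      fix v
      have "\<kappa> * norm (matrix_inv ?J *v v) \<le> norm (?J *v (matrix_inv ?J *v v))"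
        using expand[OF y(2)] .
      also have "\<dots> = norm v"
        by (simp add: matrix_vector_mul_assoc J1)
      finally show "norm (matrix_inv ?J *v v) \<le> 1 / \<kappa> * norm v"
        using \<kappa> by (simp add: field_simps)
    qed
  qed
  then show "\<exists>B. \<forall>x\<in>D. \<exists>\<Psi>'. (\<Psi> has_derivative \<Psi>') (at x) \<and> onorm \<Psi>' \<le> B"
    by blast
qed

text \<open>Without convexity of \<open>D\<close>, the derivative bound for the inverse controls
  only points joined by a segment in \<open>D\<close>, which suffices on normal lines. Continuity up
  to the closure gives meaning to the trace on the graph.\<close>

lemma mapped_bspline_regularity:
  fixes \<Phi> :: "real ^ 'n \<Rightarrow> real ^ 'n"
  assumes \<Xi>: "\<forall>i. open_knot_vector p (\<Xi> i)" and param: "bspline_parametrization \<Xi> p \<Phi> D" and D: "open D"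
    and \<phi>: "\<phi> \<in> mapped_bspline_space \<Xi> p \<Phi>"
  obtains L N where "compact N" "negligible N" "continuous_on (closure D) \<phi>" "0 \<le> L"
    "\<And>x y. closed_segment x y \<subseteq> D \<Longrightarrow> \<bar>\<phi> x - \<phi> y\<bar> \<le> L * dist x y"
    "\<And>x. x \<in> D - N \<Longrightarrow> \<phi> differentiable (at x)"
proof -
  let ?Q = "cbox 0 1 :: (real ^ 'n) set"
  define \<Psi> where "\<Psi> = inv_into ?Q \<Phi>"
  note inv = bspline_parametrization_inverse[OF param D, folded \<Psi>_def]
  obtain c where c: "\<phi> = (\<lambda>x. \<Sum>j\<in>bspline_indices \<Xi> p. c j * tensor_bspline \<Xi> p j (\<Psi> x))"
    using \<phi> by (auto simp: mapped_bspline_space_def \<Psi>_def)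
  define S where "S y = (\<Sum>j\<in>bspline_indices \<Xi> p. c j * tensor_bspline \<Xi> p j y)" for y
  have \<phi>S: "\<phi> = (\<lambda>x. S (\<Psi> x))"
    by (simp add: c S_def)
  obtain K where K: "K-lipschitz_on ?Q S"
    using spline_lipschitz_on[OF \<Xi>] unfolding S_def[abs_def] by blast
  obtain B where B: "\<And>x. x \<in> D \<Longrightarrow> \<exists>\<Psi>'. (\<Psi> has_derivative \<Psi>') (at x) \<and> onorm \<Psi>' \<le> B"
    using inv(5) by blast
  then obtain \<Psi>' where \<Psi>': "\<And>x. x \<in> D \<Longrightarrow> (\<Psi> has_derivative \<Psi>' x) (at x)" "\<And>x. x \<in> D \<Longrightarrow> onorm (\<Psi>' x) \<le> B"
    by metis
  have diff: "\<And>x. x \<in> ?Q \<Longrightarrow> \<Phi> differentiable (at x within ?Q)" and inj: "inj_on \<Phi> ?Q" and img: "\<Phi> ` box 0 1 = D"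
    using param by (auto simp: bspline_parametrization_def)
  \<comment> \<open>The end knots 0 and 1 put the faces of the cube into \<open>E\<close> too. This
    costs nothing: \<open>D\<close> is the image of the open cube and \<open>\<Phi>\<close> is
    injective on the closed one.\<close>
  define E where "E = (\<Union>i. \<Union>t\<in>set (\<Xi> i). ?Q \<inter> {y. y $ i = t})"
  have E: "compact E" "negligible E" "E \<subseteq> ?Q"
  proof -
    show "compact E"
      unfolding E_def by (intro compact_UN finite_class.finite_UNIV finite_set ballI compact_Int_closed compact_cbox
          closed_Collect_eq continuous_intros)
    have "negligible {y :: real ^ 'n. y $ i = t}" for i t
      using negligible_standard_hyperplane[of "axis i (1::real)" t] by (simp add: cart_eq_inner_axis Basis_real_def)
    then have "negligible (?Q \<inter> {y. y $ i = t})" for i t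
      by (rule negligible_subset[of "{y. y $ i = t}"]) simp
    then have "negligible (\<Union>t\<in>set (\<Xi> i). ?Q \<inter> {y. y $ i = t})" for i
      by (intro negligible_Union finite_imageI finite_set) blast
    then show "negligible E"
      unfolding E_def by (intro negligible_Union finite_imageI finite_class.finite_UNIV) blast
    show "E \<subseteq> ?Q" by (auto simp: E_def)
  qed
  show ?thesis
  proof
    show "compact (\<Phi> ` E)"
      using E inv(1) by (intro compact_continuous_image) (auto intro: continuous_on_subset)
    have "\<Phi> differentiable_on E"
      using E(3) diff by (meson differentiable_on_def differentiable_on_subset)
    then show "negligible (\<Phi> ` E)"
      using E by (intro negligible_differentiable_image_negligible) auto
    have \<Psi>Q: "\<Psi> ` (\<Phi> ` ?Q) \<subseteq> ?Q"
      unfolding \<Psi>_def by (auto intro: inv_into_into)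
    show "continuous_on (closure D) \<phi>"
      unfolding \<phi>S
    proof (rule continuous_on_compose2[OF lipschitz_on_continuous_on[OF K]])
      show "continuous_on (closure D) \<Psi>"
        using inv(2,3) by (rule_tac continuous_on_subset) auto
      show "\<Psi> ` closure D \<subseteq> ?Q"
        using inv(2) \<Psi>Q by blast
    qed
    show "0 \<le> K * \<bar>B\<bar>"
      using lipschitz_on_nonneg[OF K] by simp
    show "\<bar>\<phi> x - \<phi> y\<bar> \<le> K * \<bar>B\<bar> * dist x y" if seg: "closed_segment x y \<subseteq> D" for x y
    proof -
      have xy: "x \<in> D" "y \<in> D"
        using subsetD[OF seg] by (simp_all only: ends_in_segment)
      have "norm (\<Psi> x - \<Psi> y) \<le> B * norm (x - y)"
      proof (rule differentiable_bound[of "closed_segment x y" \<Psi> \<Psi>'])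
        show "(\<Psi> has_derivative \<Psi>' z) (at z within closed_segment x y)" if "z \<in> closed_segment x y" for z
          using subsetD[OF seg that] by (rule has_derivative_at_withinI[OF \<Psi>'(1)])
        show "onorm (\<Psi>' z) \<le> B" if "z \<in> closed_segment x y" for z
          using subsetD[OF seg that] by (rule \<Psi>'(2))
      qed (simp_all only: convex_closed_segment ends_in_segment)
      also have "\<dots> \<le> \<bar>B\<bar> * norm (x - y)"
        by (intro mult_right_mono) auto
      finally have *: "dist (\<Psi> x) (\<Psi> y) \<le> \<bar>B\<bar> * dist x y"
        by (simp add: dist_norm)
      have "\<Psi> x \<in> ?Q" "\<Psi> y \<in> ?Q"
        using inv(4) xy box_subset_cbox by blast+
      then have "dist (S (\<Psi> x)) (S (\<Psi> y)) \<le> K * dist (\<Psi> x) (\<Psi> y)"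
        by (rule lipschitz_onD[OF K])
      also have "\<dots> \<le> K * (\<bar>B\<bar> * dist x y)"
        using * lipschitz_on_nonneg[OF K] by (intro mult_left_mono)
      finally show ?thesis
        by (simp add: \<phi>S dist_real_def mult.assoc)
    qed
    show "\<phi> differentiable (at x)" if x: "x \<in> D - \<Phi> ` E" for x
    proof -
      have y: "\<Psi> x \<in> ?Q" "\<Phi> (\<Psi> x) = x"
        using x inv(4)[of x] box_subset_cbox img unfolding \<Psi>_def
        by (auto simp: subset_iff intro!: f_inv_into_f)
      then have "\<Psi> x \<notin> E"
        using x by (metis DiffD2 imageI)
      then have "S differentiable (at (\<Psi> x))"
        unfolding S_def[abs_def] using y by (intro spline_differentiable) (auto simp: E_def)
      moreover have "\<Psi> differentiable (at x)"
        using x \<Psi>'(1) by (auto simp: differentiable_def)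
      ultimately show ?thesis
        unfolding \<phi>S using differentiable_chain_at[of \<Psi> x S] by (simp add: o_def)
    qed
  qed
qed

subsection \<open>Classical gradients\<close>

lemma frechet_derivative_eq_grad:
  assumes "\<phi> differentiable (at x)"
  shows "frechet_derivative \<phi> (at x) v = grad \<phi> x \<bullet> v"
proof -
  have lin: "linear (frechet_derivative \<phi> (at x))"
    using assms by (rule linear_frechet_derivative)
  have "frechet_derivative \<phi> (at x) (\<Sum>i\<in>UNIV. v $ i *\<^sub>R axis i 1)
      = (\<Sum>i\<in>UNIV. v $ i * frechet_derivative \<phi> (at x) (axis i 1))"
    by (simp add: linear_sum[OF lin] linear_scale[OF lin])
  also have "(\<Sum>i\<in>UNIV. v $ i *\<^sub>R axis i 1) = v"
    using basis_expansion[of v] by (simp add: scalar_mult_eq_scaleR)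
  finally show ?thesis
    by (simp add: grad_def inner_vec_def mult.commute)
qed

lemma has_real_derivative_along_line:
  assumes "\<phi> differentiable (at (y + s *\<^sub>R e))"
  shows "((\<lambda>t. \<phi> (y + t *\<^sub>R e)) has_real_derivative grad \<phi> (y + s *\<^sub>R e) \<bullet> e) (at s)"
proof -
  have "(\<phi> has_derivative (\<lambda>v. grad \<phi> (y + s *\<^sub>R e) \<bullet> v)) (at (y + s *\<^sub>R e))"
    using assms unfolding frechet_derivative_works by (simp add: frechet_derivative_eq_grad[OF assms, symmetric])
  moreover have "((\<lambda>t. y + t *\<^sub>R e) has_derivative (\<lambda>t. t *\<^sub>R e)) (at s)"
    by (auto intro!: derivative_eq_intros)
  ultimately have "((\<lambda>t. \<phi> (y + t *\<^sub>R e)) has_derivative (\<lambda>t. grad \<phi> (y + s *\<^sub>R e) \<bullet> (t *\<^sub>R e))) (at s)"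
    by (rule has_derivative_compose[rotated])
  then show ?thesis
    by (simp add: has_field_derivative_def mult_commute_abs)
qed

text \<open>In the direction of the gradient \<open>e\<close> itself the derivative is
  \<open>e \<bullet> e\<close>, while the difference quotients are at most
  \<open>L * norm e\<close>.\<close>

lemma norm_grad_le:
  fixes \<phi> :: "real ^ 'n \<Rightarrow> real"
  assumes D: "open D" "x \<in> D" and diff: "\<phi> differentiable (at x)"
    and lip: "\<And>y. closed_segment x y \<subseteq> D \<Longrightarrow> \<bar>\<phi> x - \<phi> y\<bar> \<le> L * dist x y"
  shows "norm (grad \<phi> x) \<le> L"
proof -
  define e where "e = grad \<phi> x"
  obtain r where r: "0 < r" "ball x r \<subseteq> D"
    using D open_contains_ball by blast
  have "((\<lambda>t. \<phi> (x + t *\<^sub>R e)) has_real_derivative e \<bullet> e) (at 0)"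
    using has_real_derivative_along_line[of \<phi> x 0 e] diff by (simp add: e_def)
  then have "((\<lambda>t. \<bar>(\<phi> (x + t *\<^sub>R e) - \<phi> x) / t\<bar>) \<longlongrightarrow> \<bar>e \<bullet> e\<bar>) (at 0)"
    by (intro tendsto_rabs) (simp add: DERIV_def)
  moreover have "eventually (\<lambda>t. \<bar>(\<phi> (x + t *\<^sub>R e) - \<phi> x) / t\<bar> \<le> L * norm e) (at 0)"
  proof -
    have "isCont (\<lambda>t. x + t *\<^sub>R e) 0"
      by (intro continuous_intros)
    then have "((\<lambda>t. x + t *\<^sub>R e) \<longlongrightarrow> x) (at 0)"
      by (simp add: isCont_def)
    then have "eventually (\<lambda>t. x + t *\<^sub>R e \<in> ball x r) (at 0)"
      using r by (intro topological_tendstoD) auto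
    moreover have "eventually (\<lambda>t::real. t \<noteq> 0) (at 0)"
      by (simp add: eventually_at_filter)
    ultimately show ?thesis
    proof eventually_elim
      case (elim t)
      have "closed_segment x (x + t *\<^sub>R e) \<subseteq> ball x r"
        using elim r by (intro closed_segment_subset) auto
      then have "\<bar>\<phi> x - \<phi> (x + t *\<^sub>R e)\<bar> \<le> L * dist x (x + t *\<^sub>R e)"
        using r by (intro lip) auto
      then have "\<bar>\<phi> (x + t *\<^sub>R e) - \<phi> x\<bar> \<le> L * norm e * \<bar>t\<bar>"
        by (simp add: dist_norm abs_minus_commute mult_ac)
      then show ?case
        using elim by (simp add: divide_le_eq)
    qed
  qed
  ultimately have "\<bar>e \<bullet> e\<bar> \<le> L * norm e"
    by (intro tendsto_upperbound[of _ _ "at 0"]) auto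
  then have "norm e * norm e \<le> L * norm e"
    by (simp add: dot_square_norm power2_eq_square)
  \<comment> \<open>If the gradient vanishes, nothing can be cancelled and the claim is just
    \<open>0 \<le> L\<close>; any nondegenerate segment in \<open>D\<close> supplies it, here in an
    arbitrary axis direction.\<close>
  moreover have "0 \<le> L" if "e = 0"
  proof -
    have "closed_segment x (x + (r / 2) *\<^sub>R axis undefined 1) \<subseteq> ball x r"
      using r by (intro closed_segment_subset) (auto simp: dist_norm)
    then have "0 \<le> L * dist x (x + (r / 2) *\<^sub>R axis undefined 1)"
      using lip r by (meson abs_ge_zero order_trans)
    then show ?thesis
      using r by (simp add: dist_norm zero_le_mult_iff)
  qed
  ultimately show ?thesis
    by (cases "e = 0") (auto simp: e_def)
qed

text \<open>Each component is a pointwise limit of difference quotients of the zero extension of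
  \<open>\<phi>\<close>, which is Borel. The indicator removes the points where \<open>grad\<close>
  may be an unspecified value.\<close>

lemma grad_borel_measurable:
  fixes \<phi> :: "real ^ 'n \<Rightarrow> real"
  assumes D: "open D" and cont: "continuous_on D \<phi>" and G: "G \<in> sets borel" "G \<subseteq> D"
    and diff: "\<And>x. x \<in> G \<Longrightarrow> \<phi> differentiable (at x)"
  shows "(\<lambda>x. indicator G x *\<^sub>R grad \<phi> x) \<in> borel_measurable borel"
proof -
  define \<psi> where "\<psi> x = (if x \<in> D then \<phi> x else 0)" for x
  define \<delta> where "\<delta> k = inverse (real (Suc k))" for k
  have \<psi>: "\<psi> \<in> borel_measurable borel"
    unfolding \<psi>_def using D cont by (intro borel_measurable_continuous_on_if) auto
  have \<delta>: "filterlim \<delta> (at 0) sequentially"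
    using LIMSEQ_inverse_real_of_nat unfolding filterlim_at \<delta>_def
    by (auto simp: eventually_sequentially intro!: exI[of _ 0])
  have "(\<lambda>x. indicator G x * grad \<phi> x $ i) \<in> borel_measurable borel" for i
  proof (rule borel_measurable_LIMSEQ_real)
    let ?q = "\<lambda>k x. indicator G x * ((\<psi> (x + \<delta> k *\<^sub>R axis i 1) - \<psi> x) / \<delta> k)"
    show "?q k \<in> borel_measurable borel" for k
      using G \<psi> by measurable
    fix x :: "real ^ 'n"
    show "(\<lambda>k. ?q k x) \<longlonglongrightarrow> indicator G x * grad \<phi> x $ i"
    proof (cases "x \<in> G")
      case True
      have "((\<lambda>t. \<phi> (x + t *\<^sub>R axis i 1)) has_real_derivative grad \<phi> x \<bullet> axis i 1) (at 0)"
        using has_real_derivative_along_line[of \<phi> x 0 "axis i 1"] diff[OF True] by simp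
      then have "((\<lambda>t. (\<phi> (x + t *\<^sub>R axis i 1) - \<phi> x) / t) \<longlongrightarrow> grad \<phi> x $ i) (at 0)"
        by (simp add: DERIV_def inner_axis)
      then have "(\<lambda>k. (\<phi> (x + \<delta> k *\<^sub>R axis i 1) - \<phi> x) / \<delta> k) \<longlonglongrightarrow> grad \<phi> x $ i"
        using \<delta> by (rule filterlim_compose)
      moreover have "eventually (\<lambda>k. (\<phi> (x + \<delta> k *\<^sub>R axis i 1) - \<phi> x) / \<delta> k = ?q k x) sequentially"
      proof -
        have "isCont (\<lambda>t. x + t *\<^sub>R axis i (1::real)) 0"
          by (intro continuous_intros)
        then have "((\<lambda>t. x + t *\<^sub>R axis i 1) \<longlongrightarrow> x) (at 0)"
          by (simp add: isCont_def)
        then have "(\<lambda>k. x + \<delta> k *\<^sub>R axis i 1) \<longlonglongrightarrow> x"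
          using \<delta> by (rule filterlim_compose)
        then have "eventually (\<lambda>k. x + \<delta> k *\<^sub>R axis i 1 \<in> D) sequentially"
          using True G D by (intro topological_tendstoD) auto
        then show ?thesis
          by eventually_elim (use True G in \<open>auto simp: \<psi>_def\<close>)
      qed
      ultimately show ?thesis
        using True by (simp add: tendsto_cong)
    qed simp
  qed
  then show ?thesis
    by (subst borel_measurable_euclidean_space) (auto simp: Basis_vec_def inner_axis)
qed

subsection \<open>The region between two graphs\<close>

text \<open>The sign of \<open>z w\<close> is left open, hence \<open>min\<close> and
  \<open>max\<close> with 0. By \<open>off\<close> the two graph points are not in \<open>X\<close>,
  so a normal line falls into at most three open pieces free of frontier points; the two unbounded
  ones are incompatible with the boundedness of \<open>X\<close>.\<close>

lemma region_between_graphs_column: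
  fixes A :: "real ^ 'm \<Rightarrow> real ^ 'n" and z :: "real ^ 'm \<Rightarrow> real"
  assumes frame: "hyperplane_frame A n" and X: "open X" "bounded X"
    and front: "frontier X \<subseteq> (\<lambda>w. a + A w) ` cbox 0 M \<union> (\<lambda>w. a + A w + z w *\<^sub>R n) ` cbox 0 M"
    and off: "\<forall>w\<in>box 0 M. a + A w \<notin> X \<and> a + A w + z w *\<^sub>R n \<notin> X"
    and t: "a + A w + t *\<^sub>R n \<in> X"
  shows "w \<in> box 0 M" "t \<in> {min 0 (z w)<..<max 0 (z w)}"
    "\<And>s. s \<in> {min 0 (z w)<..<max 0 (z w)} \<Longrightarrow> a + A w + s *\<^sub>R n \<in> X"
proof -
  have lin: "linear A" and n: "norm n = 1"
    using frame by (auto simp: hyperplane_frame_def)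
  define T where "T v s = a + A v + s *\<^sub>R n" for v s
  have T_inj: "v = v' \<and> s = s'" if "T v s = T v' s'" for v v' s s'
  proof -
    have "dist (v, s) (v', s') = 0"
      unfolding hyperplane_coordinates_dist[OF frame, of a, symmetric] using that by (simp add: T_def)
    then show ?thesis by simp
  qed
  have T_front: "v \<in> cbox 0 M \<and> (s = 0 \<or> s = z v)" if "T v s \<in> frontier X" for v s
  proof -
    have "T v s \<in> (\<lambda>w. T w 0) ` cbox 0 M \<union> (\<lambda>w. T w (z w)) ` cbox 0 M"
      using subsetD[OF front that] by (simp add: T_def)
    then show ?thesis
      using T_inj by blast
  qed
  have contT: "continuous_on S (T v)" for S v
    unfolding T_def by (intro continuous_intros)
  have conn: "T v s \<in> X" if "connected C" "r \<in> C" "s \<in> C" "T v r \<in> X" "\<And>q. q \<in> C \<Longrightarrow> T v q \<notin> frontier X" for C v r s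
  proof (rule ccontr)
    assume "T v s \<notin> X"
    then have "T v ` C \<inter> frontier X \<noteq> {}"
      using that by (intro connected_Int_frontier connected_continuous_image contT) auto
    then show False using that(5) by auto
  qed
  obtain b where b: "\<And>x. x \<in> X \<Longrightarrow> norm x \<le> b"
    using X(2) by (auto simp: bounded_iff)
  have far: "T v s \<notin> X" if "\<bar>s\<bar> > b + norm (a + A v)" for v s
  proof
    assume "T v s \<in> X"
    then have "norm (T v s) \<le> b" by (rule b)
    moreover have "\<bar>s\<bar> = norm (T v s - (a + A v))"
      by (simp add: T_def n)
    ultimately show False
      using that norm_triangle_ineq4[of "T v s" "a + A v"] by linarith
  qed
  \<comment> \<open>A normal line with foot outside the closed rectangle has no frontier point at
    all, so a single point in \<open>X\<close> would put the entire line into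
    \<open>X\<close>.\<close>
  have cbox: "v \<in> cbox 0 M" if "T v s \<in> X" for v s
  proof (rule ccontr)
    assume "v \<notin> cbox 0 M"
    then have "T v (\<bar>b + norm (a + A v)\<bar> + 1) \<in> X"
      using T_front by (intro conn[OF connected_UNIV UNIV_I UNIV_I that]) blast
    then show False using far[of v "\<bar>b + norm (a + A v)\<bar> + 1"] by linarith
  qed
  \<comment> \<open>Feet on the edges, where \<open>off\<close> says nothing, are excluded by
    openness: an open subset of the closed rectangle lies in its interior.\<close>
  have "(\<lambda>v. T v t) -` X \<subseteq> interior (cbox 0 M)"
  proof (rule interior_maximal)
    show "(\<lambda>v. T v t) -` X \<subseteq> cbox 0 M"
      using cbox by auto
    have "continuous_on UNIV (\<lambda>v. T v t)"
      unfolding T_def by (intro continuous_intros linear_continuous_on_compose[OF _ lin])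
    then show "open ((\<lambda>v. T v t) -` X)"
      using X(1) by (simp add: open_vimage)
  qed
  then show w: "w \<in> box 0 M"
    using t by (auto simp: T_def interior_cbox)
  have tX: "T w t \<in> X"
    using t by (simp add: T_def)
  have "\<not> max 0 (z w) < t"
  proof
    assume "max 0 (z w) < t"
    then have "T w (max t (\<bar>b + norm (a + A w)\<bar> + 1)) \<in> X"
      using T_front by (intro conn[OF connected_Ioi[of "max 0 (z w)"] _ _ tX]) force+
    then show False using far[of w "max t (\<bar>b + norm (a + A w)\<bar> + 1)"] by linarith
  qed
  moreover have "\<not> t < min 0 (z w)"
  proof
    assume "t < min 0 (z w)"
    then have "T w (min t (- \<bar>b + norm (a + A w)\<bar> - 1)) \<in> X"
      using T_front by (intro conn[OF connected_Iio[of "min 0 (z w)"] _ _ tX]) force+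
    then show False using far[of w "min t (- \<bar>b + norm (a + A w)\<bar> - 1)"] by linarith
  qed
  moreover have "t \<noteq> 0" "t \<noteq> z w"
    using off w t by auto
  ultimately show I: "t \<in> {min 0 (z w)<..<max 0 (z w)}"
    by (auto simp: min_def max_def split: if_splits)
  show "a + A w + s *\<^sub>R n \<in> X" if s: "s \<in> {min 0 (z w)<..<max 0 (z w)}" for s
  proof -
    have "T w s \<in> X"
      using T_front by (intro conn[OF connected_Ioo I s tX]) force
    then show ?thesis by (simp add: T_def)
  qed
qed

text \<open>Only the open segment is known to lie in \<open>D\<close>, since its ends may be on the
  graph or on the face. The Lipschitz bound is obtained inside and extended to the ends by
  continuity of \<open>\<phi>\<close> on the closure. Exceptional points on the line are tolerated
  as a null set.\<close>

lemma line_increment_squared_le: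
  fixes \<phi> :: "real ^ 'n \<Rightarrow> real"
  assumes D: "open D" and contD: "continuous_on (closure D) \<phi>" and L: "0 \<le> L"
    and lip: "\<And>x y. closed_segment x y \<subseteq> D \<Longrightarrow> \<bar>\<phi> x - \<phi> y\<bar> \<le> L * dist x y"
    and N: "closed N" and diff: "\<And>x. x \<in> D - N \<Longrightarrow> \<phi> differentiable (at x)"
    and n: "norm n = 1" and null: "AE t in lborel. y + t *\<^sub>R n \<notin> N"
    and rs: "r < s" and seg: "\<And>t. t \<in> {r<..<s} \<Longrightarrow> y + t *\<^sub>R n \<in> D"
  shows "ennreal ((\<phi> (y + s *\<^sub>R n) - \<phi> (y + r *\<^sub>R n))\<^sup>2) \<le> ennreal (s - r) *
    (\<integral>\<^sup>+t. ennreal ((norm (indicator (D - N) (y + t *\<^sub>R n) *\<^sub>R grad \<phi> (y + t *\<^sub>R n)))\<^sup>2) \<partial>lborel)"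
proof -
  define g where "g t = \<phi> (y + t *\<^sub>R n)" for t
  define G where "G x = indicator (D - N) x *\<^sub>R grad \<phi> x" for x
  define g' where "g' t = G (y + t *\<^sub>R n) \<bullet> n" for t
  have "G \<in> borel_measurable borel"
    unfolding G_def using D N diff
    by (intro grad_borel_measurable[OF D continuous_on_subset[OF contD closure_subset]]) auto
  then have meas: "g' \<in> borel_measurable borel"
    unfolding g'_def by measurable
  have contT: "continuous_on S (\<lambda>t. y + t *\<^sub>R n)" for S
    by (intro continuous_intros)
  have clos: "closure {r<..<s} = {r..s}"
    using rs by simp
  have "(\<lambda>t. y + t *\<^sub>R n) ` closure {r<..<s} \<subseteq> closure ((\<lambda>t. y + t *\<^sub>R n) ` {r<..<s})"
    by (rule image_closure_subset[OF contT closed_closure closure_subset])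
  also have "\<dots> \<subseteq> closure D"
    using seg by (intro closure_mono) auto
  finally have "continuous_on (closure {r<..<s}) g"
    unfolding g_def by (intro continuous_on_compose2[OF contD contT])
  moreover have "L-lipschitz_on {r<..<s} g"
  proof (rule lipschitz_onI[OF _ L])
    fix t u assume tu: "t \<in> {r<..<s}" "u \<in> {r<..<s}"
    have "closed_segment (y + t *\<^sub>R n) (y + u *\<^sub>R n) \<subseteq> D"
    proof
      fix x assume "x \<in> closed_segment (y + t *\<^sub>R n) (y + u *\<^sub>R n)"
      then obtain q where q: "0 \<le> q" "q \<le> 1" "x = (1 - q) *\<^sub>R (y + t *\<^sub>R n) + q *\<^sub>R (y + u *\<^sub>R n)"
        by (auto simp: in_segment)
      have "(1 - q) * t + q * u \<in> {r<..<s}"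
        using convexD[of "{r<..<s}" t u "1 - q" q] tu q by simp
      moreover have "x = y + ((1 - q) * t + q * u) *\<^sub>R n"
        unfolding q(3) by (simp add: algebra_simps)
      ultimately show "x \<in> D"
        using seg by blast
    qed
    then have "\<bar>g t - g u\<bar> \<le> L * dist (y + t *\<^sub>R n) (y + u *\<^sub>R n)"
      unfolding g_def by (rule lip)
    also have "dist (y + t *\<^sub>R n) (y + u *\<^sub>R n) = dist t u"
      using n by (simp add: dist_norm scaleR_diff_left[symmetric])
    finally show "dist (g t) (g u) \<le> L * dist t u"
      by (simp add: dist_real_def)
  qed
  ultimately have "L-lipschitz_on {r..s} g"
    using lipschitz_on_closure clos by metis
  moreover have "AE t in lborel. t \<in> {r<..<s} \<longrightarrow> (g has_real_derivative g' t) (at t)"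
    using null
  proof eventually_elim
    case (elim t)
    show ?case
    proof
      assume "t \<in> {r<..<s}"
      then have x: "y + t *\<^sub>R n \<in> D - N"
        using elim seg by blast
      then have "g' t = grad \<phi> (y + t *\<^sub>R n) \<bullet> n"
        by (simp add: g'_def G_def)
      then show "(g has_real_derivative g' t) (at t)"
        unfolding g_def using has_real_derivative_along_line[OF diff[OF x]] by simp
    qed
  qed
  ultimately have "ennreal ((g s - g r)\<^sup>2) \<le> ennreal (s - r) * (\<integral>\<^sup>+t. ennreal ((g' t)\<^sup>2) \<partial>lborel)"
    using rs meas by (intro lipschitz_increment_squared_le) auto
  also have "\<dots> \<le> ennreal (s - r) * (\<integral>\<^sup>+t. ennreal ((norm (G (y + t *\<^sub>R n)))\<^sup>2) \<partial>lborel)"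
  proof (intro mult_left_mono nn_integral_mono ennreal_leI)
    fix t
    have "\<bar>g' t\<bar> \<le> norm (G (y + t *\<^sub>R n))"
      using Cauchy_Schwarz_ineq2[of "G (y + t *\<^sub>R n)" n] n by (simp add: g'_def)
    then show "(g' t)\<^sup>2 \<le> (norm (G (y + t *\<^sub>R n)))\<^sup>2"
      using abs_le_square_iff[of "g' t" "norm (G (y + t *\<^sub>R n))"] by simp
  qed simp
  finally show ?thesis
    by (simp add: g_def G_def)
qed

text \<open>On each column the pointwise bound does not depend on \<open>t\<close>, so integrating
  over a segment of length at most \<open>d\<close> costs one more factor \<open>d\<close>: this
  gives \<open>2 * d\<close> for the trace and \<open>2 * d\<^sup>2\<close> for the gradient. The
  gradient is integrated along the whole normal line, hence over \<open>D\<close> instead of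
  \<open>X\<close>.\<close>

lemma nn_integral_region_between_graphs_le:
  fixes A :: "real ^ 'm \<Rightarrow> real ^ 'n" and z :: "real ^ 'm \<Rightarrow> real"
  assumes frame: "hyperplane_frame A n" and card: "CARD('m) + 1 = CARD('n)"
    and X: "open X" "bounded X" "X \<subseteq> D"
    and front: "frontier X \<subseteq> (\<lambda>w. a + A w) ` cbox 0 M \<union> (\<lambda>w. a + A w + z w *\<^sub>R n) ` cbox 0 M"
    and off: "\<forall>w\<in>box 0 M. a + A w \<notin> X \<and> a + A w + z w *\<^sub>R n \<notin> X"
    and contz: "continuous_on (box 0 M) z"
    and zd: "\<And>w. w \<in> box 0 M \<Longrightarrow> \<bar>z w\<bar> \<le> d"
    and zD: "\<And>w. w \<in> box 0 M \<Longrightarrow> a + A w + z w *\<^sub>R n \<in> closure D"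
    and D: "open D" and contD: "continuous_on (closure D) \<phi>" and L: "0 \<le> L"
    and lip: "\<And>x y. closed_segment x y \<subseteq> D \<Longrightarrow> \<bar>\<phi> x - \<phi> y\<bar> \<le> L * dist x y"
    and N: "compact N" "negligible N" and diff: "\<And>x. x \<in> D - N \<Longrightarrow> \<phi> differentiable (at x)"
    and d: "0 \<le> d"
  shows "(\<integral>\<^sup>+x. ennreal ((\<phi> x)\<^sup>2) * indicator X x \<partial>lborel) \<le>
     ennreal (2 * d) * (\<integral>\<^sup>+w. ennreal ((\<phi> (a + A w + z w *\<^sub>R n))\<^sup>2) * indicator (box 0 M) w \<partial>lborel)
     + ennreal (2 * d\<^sup>2) * (\<integral>\<^sup>+x. ennreal ((norm (indicator (D - N) x *\<^sub>R grad \<phi> x))\<^sup>2) \<partial>lborel)"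
proof -
  have lin: "linear A" and n: "norm n = 1"
    using frame by (auto simp: hyperplane_frame_def)
  have Nc: "closed N"
    using N(1) by (rule compact_imp_closed)
  define T where "T w t = a + A w + t *\<^sub>R n" for w t
  define G where "G x = ennreal ((norm (indicator (D - N) x *\<^sub>R grad \<phi> x))\<^sup>2)" for x
  define \<tau> where "\<tau> w = (\<phi> (T w (z w)))\<^sup>2" for w
  define I where "I w = (\<integral>\<^sup>+t. G (T w t) \<partial>lborel)" for w
  have contA: "continuous_on S (\<lambda>w. a + A w + f w *\<^sub>R n)" if "continuous_on S f" for S f
    using that by (intro continuous_intros linear_continuous_on_compose[OF _ lin])
  have Gm: "G \<in> borel_measurable borel"
  proof -
    have "(\<lambda>x. indicator (D - N) x *\<^sub>R grad \<phi> x) \<in> borel_measurable borel"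
      using D Nc diff by (intro grad_borel_measurable[OF D continuous_on_subset[OF contD closure_subset]]) auto
    then show ?thesis
      unfolding G_def by measurable
  qed
  have Tm: "case_prod T \<in> borel_measurable (lborel \<Otimes>\<^sub>M lborel)"
    unfolding lborel_prod case_prod_beta measurable_lborel2 T_def
    by (intro borel_measurable_continuous_onI continuous_intros linear_continuous_on_compose[OF _ lin])
  have Im: "I \<in> borel_measurable lborel"
    unfolding I_def using measurable_compose[OF Tm Gm]
    by (intro lborel.borel_measurable_nn_integral) (simp add: case_prod_beta)
  have \<tau>m: "(\<lambda>w. ennreal (\<tau> w) * indicator (box 0 M) w) \<in> borel_measurable lborel"
  proof -
    have "continuous_on (box 0 M) \<tau>"
      unfolding \<tau>_def T_def using zD by (intro continuous_intros continuous_on_compose2[OF contD contA[OF contz]]) auto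
    then have "(\<lambda>w. if w \<in> box 0 M then \<tau> w else 0) \<in> borel_measurable borel"
      by (intro borel_measurable_continuous_on_if) auto
    then have "(\<lambda>w. ennreal (if w \<in> box 0 M then \<tau> w else 0)) \<in> borel_measurable lborel"
      by measurable
    also have "(\<lambda>w. ennreal (if w \<in> box 0 M then \<tau> w else 0)) = (\<lambda>w. ennreal (\<tau> w) * indicator (box 0 M) w)"
      by (auto simp: fun_eq_iff indicator_def)
    finally show ?thesis .
  qed
  have \<phi>m: "(\<lambda>x. ennreal ((\<phi> x)\<^sup>2) * indicator X x) \<in> borel_measurable borel"
  proof -
    have "continuous_on X (\<lambda>x. (\<phi> x)\<^sup>2)"
      by (intro continuous_intros continuous_on_subset[OF contD] order_trans[OF X(3) closure_subset])
    then have "(\<lambda>x. if x \<in> X then (\<phi> x)\<^sup>2 else 0) \<in> borel_measurable borel"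
      using X by (intro borel_measurable_continuous_on_if) auto
    then have "(\<lambda>x. ennreal (if x \<in> X then (\<phi> x)\<^sup>2 else 0)) \<in> borel_measurable borel"
      by measurable
    also have "(\<lambda>x. ennreal (if x \<in> X then (\<phi> x)\<^sup>2 else 0)) = (\<lambda>x. ennreal ((\<phi> x)\<^sup>2) * indicator X x)"
      by (auto simp: fun_eq_iff indicator_def)
    finally show ?thesis .
  qed
  \<comment> \<open>Tonelli for the indicator of \<open>N\<close>: a null set meets almost every
    normal line in a null set, although exceptional lines may run inside \<open>N\<close>.\<close>
  have null: "AE w in lborel. AE t in lborel. T w t \<notin> N"
  proof -
    have "N \<in> null_sets lborel"
      using N Nc by (simp add: negligible_iff_null_sets null_sets_def)
    then have "0 = (\<integral>\<^sup>+x. indicator N x \<partial>lborel)"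
      by (simp add: null_sets_def)
    also have "\<dots> = (\<integral>\<^sup>+w. (\<integral>\<^sup>+t. indicator N (T w t) \<partial>lborel) \<partial>lborel)"
      unfolding T_def using Nc by (intro nn_integral_hyperplane_coordinates[OF frame card]) auto
    finally have "AE w in lborel. (\<integral>\<^sup>+t. indicator N (T w t) \<partial>lborel) = (0::ennreal)"
    proof (subst nn_integral_0_iff_AE[symmetric])
      have "(\<lambda>x. indicator N x :: ennreal) \<in> borel_measurable borel"
        using Nc by auto
      from measurable_compose[OF Tm this]
      show "(\<lambda>w. \<integral>\<^sup>+t. indicator N (T w t) \<partial>lborel :: ennreal) \<in> borel_measurable lborel"
        by (intro lborel.borel_measurable_nn_integral) (simp add: case_prod_beta)
    qed simp
    then show ?thesis
    proof eventually_elim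
      case (elim w)
      have "T w \<in> borel_measurable borel"
        unfolding T_def by (intro borel_measurable_continuous_onI continuous_intros)
      then have "(\<lambda>t. indicator N (T w t) :: ennreal) \<in> borel_measurable lborel"
        using Nc by (intro measurable_compose[where f="T w" and g="indicator N"]) auto
      then have "AE t in lborel. indicator N (T w t) = (0::ennreal)"
        using elim by (simp add: nn_integral_0_iff_AE)
      then show ?case
        by eventually_elim (auto simp: indicator_def split: if_splits)
    qed
  qed
  have column: "(\<integral>\<^sup>+t. ennreal ((\<phi> (T w t))\<^sup>2) * indicator X (T w t) \<partial>lborel)
      \<le> ennreal (2 * d) * (ennreal (\<tau> w) * indicator (box 0 M) w) + ennreal (2 * d\<^sup>2) * I w"
    if w: "AE t in lborel. T w t \<notin> N" for w
  proof (cases "\<exists>t. T w t \<in> X")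
    case False
    then show ?thesis by simp
  next
    case True
    then obtain t0 where "T w t0 \<in> X" by blast
    note col = region_between_graphs_column[OF frame X(1,2) front off, folded T_def]
    have wbox: "w \<in> box 0 M"
      using col(1)[OF \<open>T w t0 \<in> X\<close>] .
    let ?J = "{min 0 (z w)<..<max 0 (z w)}"
    have J: "t \<in> ?J" if "T w t \<in> X" for t
      using col(2)[OF that] .
    have JX: "T w t \<in> D" if "t \<in> ?J" for t
      using col(3)[OF \<open>T w t0 \<in> X\<close> that] X(3) by blast
    let ?C = "ennreal (2 * \<tau> w) + ennreal (2 * d) * I w"
    have point: "ennreal ((\<phi> (T w t))\<^sup>2) \<le> ?C" if t: "t \<in> ?J" for t
    proof -
      \<comment> \<open>Ordering \<open>t\<close> and \<open>z w\<close> treats graphs above and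
        below the face at once; the squared increment does not notice the exchange.\<close>
      define r s where "r = min t (z w)" and "s = max t (z w)"
      have rs: "r < s" "s - r \<le> d"
        using t zd[OF wbox] by (auto simp: r_def s_def min_def max_def split: if_splits)
      have sub: "{r<..<s} \<subseteq> ?J"
        using t by (auto simp: r_def s_def min_def max_def split: if_splits)
      have "ennreal ((\<phi> (T w s) - \<phi> (T w r))\<^sup>2) \<le> ennreal (s - r) * I w"
        unfolding I_def G_def T_def
        using JX sub w by (intro line_increment_squared_le[OF D contD L lip Nc diff n _ rs(1)]) (auto simp: T_def)
      also have "\<dots> \<le> ennreal d * I w"
        using rs by (intro mult_right_mono ennreal_leI) auto
      finally have incr: "ennreal ((\<phi> (T w s) - \<phi> (T w r))\<^sup>2) \<le> ennreal d * I w" .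
      have "(\<phi> (T w t) - \<phi> (T w (z w)))\<^sup>2 = (\<phi> (T w s) - \<phi> (T w r))\<^sup>2"
        by (auto simp: r_def s_def min_def max_def power2_commute)
      \<comment> \<open>The difference of the two sides is the square of
        \<open>\<phi> (T w t) - 2 * \<phi> (T w (z w))\<close>.\<close>
      then have "(\<phi> (T w t))\<^sup>2 \<le> 2 * \<tau> w + 2 * (\<phi> (T w s) - \<phi> (T w r))\<^sup>2"
        using zero_le_power2[of "\<phi> (T w t) - 2 * \<phi> (T w (z w))"]
        unfolding \<tau>_def by (simp add: power2_eq_square algebra_simps)
      then have "ennreal ((\<phi> (T w t))\<^sup>2) \<le> ennreal (2 * \<tau> w + 2 * (\<phi> (T w s) - \<phi> (T w r))\<^sup>2)"
        by (rule ennreal_leI)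
      also have "\<dots> = ennreal (2 * \<tau> w) + 2 * ennreal ((\<phi> (T w s) - \<phi> (T w r))\<^sup>2)"
        by (simp add: \<tau>_def ennreal_plus ennreal_mult)
      also have "\<dots> \<le> ennreal (2 * \<tau> w) + 2 * (ennreal d * I w)"
        by (intro add_left_mono mult_left_mono incr) simp
      also have "2 * (ennreal d * I w) = ennreal (2 * d) * I w"
        using d by (simp add: ennreal_mult mult.assoc)
      finally show ?thesis .
    qed
    have "(\<integral>\<^sup>+t. ennreal ((\<phi> (T w t))\<^sup>2) * indicator X (T w t) \<partial>lborel) \<le> (\<integral>\<^sup>+t. ?C * indicator ?J t \<partial>lborel)"
    proof (rule nn_integral_mono)
      fix t
      show "ennreal ((\<phi> (T w t))\<^sup>2) * indicator X (T w t) \<le> ?C * indicator ?J t"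
      proof (cases "T w t \<in> X")
        case True
        then show ?thesis using point[OF J[OF True]] J[OF True] by simp
      qed simp
    qed
    also have "\<dots> = ?C * ennreal (max 0 (z w) - min 0 (z w))"
      by (subst nn_integral_cmult_indicator) auto
    also have "\<dots> \<le> ?C * ennreal d"
      using zd[OF wbox] by (intro mult_left_mono ennreal_leI) auto
    also have "\<dots> = ennreal (2 * d) * ennreal (\<tau> w) + ennreal (2 * d\<^sup>2) * I w"
    proof -
      have "ennreal (2 * \<tau> w) * ennreal d = ennreal (2 * d) * ennreal (\<tau> w)"
        using d by (simp add: ennreal_mult[symmetric] \<tau>_def mult_ac)
      moreover have "ennreal (2 * d) * I w * ennreal d = ennreal (2 * d) * ennreal d * I w"
        by (simp add: mult_ac)
      moreover have "ennreal (2 * d) * ennreal d = ennreal (2 * d\<^sup>2)"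
        using d by (simp add: ennreal_mult[symmetric] power2_eq_square)
      ultimately show ?thesis
        by (simp add: distrib_right)
    qed
    finally show ?thesis
      using wbox by simp
  qed
  have "(\<integral>\<^sup>+x. ennreal ((\<phi> x)\<^sup>2) * indicator X x \<partial>lborel)
      = (\<integral>\<^sup>+w. (\<integral>\<^sup>+t. ennreal ((\<phi> (T w t))\<^sup>2) * indicator X (T w t) \<partial>lborel) \<partial>lborel)"
    unfolding T_def by (rule nn_integral_hyperplane_coordinates[OF frame card \<phi>m])
  also have "\<dots> \<le> (\<integral>\<^sup>+w. ennreal (2 * d) * (ennreal (\<tau> w) * indicator (box 0 M) w) + ennreal (2 * d\<^sup>2) * I w \<partial>lborel)"
    using null by (intro nn_integral_mono_AE) (auto elim: eventually_mono intro: column)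
  also have "\<dots> = ennreal (2 * d) * (\<integral>\<^sup>+w. ennreal (\<tau> w) * indicator (box 0 M) w \<partial>lborel) + ennreal (2 * d\<^sup>2) * (\<integral>\<^sup>+w. I w \<partial>lborel)"
    using \<tau>m Im by (simp add: nn_integral_add nn_integral_cmult)
  also have "(\<integral>\<^sup>+w. I w \<partial>lborel) = (\<integral>\<^sup>+x. G x \<partial>lborel)"
    unfolding I_def T_def by (rule nn_integral_hyperplane_coordinates[OF frame card Gm, symmetric])
  finally show ?thesis
    by (simp add: \<tau>_def T_def G_def)
qed

subsection \<open>The overlap estimate\<close>

lemma knot_spans_nonempty:
  assumes "open_knot_vector p \<xi>"
  shows "\<exists>t. (0, t) \<in> knot_spans \<xi>"
proof -
  note k = open_knot_vectorD[OF assms]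
  define P where "P = {t \<in> set \<xi>. 0 < t}"
  have P: "finite P" "P \<noteq> {}"
    using k(4) by (auto simp: P_def)
  have "Min P \<in> P"
    using P by (rule Min_in)
  moreover have "{0<..<Min P} \<inter> set \<xi> = {}"
  proof -
    have "y \<notin> set \<xi>" if "0 < y" "y < Min P" for y
    proof
      assume "y \<in> set \<xi>"
      then have "y \<in> P" using that by (simp add: P_def)
      then show False using that Min_le[OF P(1)] by fastforce
    qed
    then show ?thesis by auto
  qed
  ultimately show ?thesis
    using k(3) by (intro exI[of _ "Min P"]) (auto simp: knot_spans_def P_def)
qed

text \<open>\<open>Max\<close> is informative only for a finite nonempty set, so both properties of
  the mesh are shown. The element \<open>cbox 0 b\<close> at the origin provides nonemptiness as
  well as a positive diameter.\<close>

lemma mesh_size_bounds: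
  fixes \<Xi> :: "'n::finite \<Rightarrow> real list"
  assumes \<Xi>: "\<forall>i. open_knot_vector p (\<Xi> i)"
  shows "0 < mesh_size \<Xi>" "mesh_size \<Xi> \<le> norm (1 :: real ^ 'n)"
proof -
  define V where "V = {a :: real ^ 'n. \<forall>i. a $ i \<in> set (\<Xi> i)}"
  have "V \<subseteq> vec_lambda ` (PiE UNIV (\<lambda>i. set (\<Xi> i)))"
  proof
    fix a assume "a \<in> V"
    then show "a \<in> vec_lambda ` (PiE UNIV (\<lambda>i. set (\<Xi> i)))"
      by (intro image_eqI[of _ _ "vec_nth a"]) (auto simp: V_def PiE_def)
  qed
  then have "finite V"
    by (rule finite_subset) (simp add: finite_PiE)
  moreover have "parametric_mesh \<Xi> \<subseteq> (\<lambda>(a, b). cbox a b) ` (V \<times> V)"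
    by (force simp: parametric_mesh_def V_def knot_spans_def)
  ultimately have fin: "finite (parametric_mesh \<Xi>)"
    by (meson finite_SigmaI finite_imageI finite_subset)
  obtain t where t: "\<And>i. (0, t i) \<in> knot_spans (\<Xi> i)"
  proof -
    have "\<forall>i. \<exists>t. (0, t) \<in> knot_spans (\<Xi> i)"
      using knot_spans_nonempty \<Xi> by blast
    then show ?thesis
      using that by metis
  qed
  define b :: "real ^ 'n" where "b = (\<chi> i. t i)"
  have t0: "0 < t i" for i
    using t[of i] by (simp add: knot_spans_def)
  have Q: "cbox 0 b \<in> parametric_mesh \<Xi>"
    unfolding parametric_mesh_def using t
    by (intro CollectI exI[of _ 0] exI[of _ b] conjI refl allI) (simp add: b_def)
  have "0 < dist 0 b"
    using t0 by (auto simp: b_def vec_eq_iff) (metis less_irrefl)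
  also have "dist 0 b \<le> diameter (cbox 0 b)"
    using t0 by (intro diameter_bounded_bound) (auto simp: mem_box_cart b_def less_imp_le)
  also have "\<dots> \<le> mesh_size \<Xi>"
    unfolding mesh_size_def using fin Q by (intro Max_ge) auto
  finally show "0 < mesh_size \<Xi>" .
  show "mesh_size \<Xi> \<le> norm (1 :: real ^ 'n)"
    unfolding mesh_size_def
  proof (rule Max.boundedI)
    show "finite (diameter ` parametric_mesh \<Xi>)" "diameter ` parametric_mesh \<Xi> \<noteq> {}"
      using fin Q by auto
    fix e assume "e \<in> diameter ` parametric_mesh \<Xi>"
    then obtain u v where e: "e = diameter (cbox u v)" and uv: "\<And>i. (u $ i, v $ i) \<in> knot_spans (\<Xi> i)"
      by (auto simp: parametric_mesh_def)
    have uv': "0 \<le> u $ i" "v $ i \<le> 1" for i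
      using uv[of i] open_knot_vectorD(2)[OF \<Xi>[rule_format, of i]] by (auto simp: knot_spans_def)
    show "e \<le> norm (1 :: real ^ 'n)"
      unfolding e
    proof (rule diameter_le)
      fix x y assume "x \<in> cbox u v" "y \<in> cbox u v"
      then have "\<bar>x $ i - y $ i\<bar> \<le> 1" for i
        using uv'[of i] by (auto simp: mem_box_cart abs_le_iff dest!: spec[of _ i])
      then show "norm (x - y) \<le> norm (1 :: real ^ 'n)"
        by (intro norm_le_componentwise_cart) simp
    qed simp
  qed
qed

text \<open>The face has empty interior in the full space, but the relative interior commutes with
  translations and injective linear maps. This parametrizes the overlap face by the open
  rectangle.\<close>

lemma rel_interior_face_chart:
  fixes A :: "real ^ 'm \<Rightarrow> real ^ 'n"
  assumes frame: "hyperplane_frame A n" and M: "\<And>i. 0 < M $ i"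
  shows "rel_interior (face_chart a A ` cbox 0 M) = face_chart a A ` box 0 M"
proof -
  have lin: "linear A" and iso: "\<And>w. norm (A w) = norm w"
    using frame by (auto simp: hyperplane_frame_def)
  have img: "face_chart a A ` S = (\<lambda>x. a + x) ` (A ` S)" for S
    by (auto simp: face_chart_def)
  have "inj A"
    using iso by (auto simp: linear_injective_0[OF lin]) (metis norm_eq_zero)
  moreover have "box 0 M \<noteq> {}"
    using M by (auto simp: box_ne_empty Basis_vec_def inner_axis)
  then have "rel_interior (cbox 0 M) = box 0 M"
    by (simp add: rel_interior_nonempty_interior interior_cbox)
  ultimately show ?thesis
    using lin by (simp add: img rel_interior_translation rel_interior_injective_linear_image linear_linear)
qed

text \<open>On \<open>N\<close> the gradient may be unspecified; replacing it by 0 there gives a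
  Borel function and changes nothing up to a null set. The bound \<open>L\<close> and the finite
  measure of \<open>D\<close> make its square integrable, so the right side is a true integral and
  not the default value 0.\<close>

lemma square_grad_integral:
  fixes \<phi> :: "real ^ 'n \<Rightarrow> real"
  assumes D: "open D" "bounded D" and contD: "continuous_on D \<phi>"
    and lip: "\<And>x y. closed_segment x y \<subseteq> D \<Longrightarrow> \<bar>\<phi> x - \<phi> y\<bar> \<le> L * dist x y"
    and N: "closed N" "negligible N" and diff: "\<And>x. x \<in> D - N \<Longrightarrow> \<phi> differentiable (at x)"
  shows "(\<integral>\<^sup>+x. ennreal ((norm (indicator (D - N) x *\<^sub>R grad \<phi> x))\<^sup>2) \<partial>lborel)
    = ennreal (LINT x:D|lebesgue. (norm (grad \<phi> x))\<^sup>2)"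
proof -
  define H where "H x = (norm (indicator (D - N) x *\<^sub>R grad \<phi> x))\<^sup>2" for x
  have "(\<lambda>x. indicator (D - N) x *\<^sub>R grad \<phi> x) \<in> borel_measurable borel"
    using D N diff by (intro grad_borel_measurable[OF D(1) contD]) auto
  then have Hm: "H \<in> borel_measurable borel"
    unfolding H_def by measurable
  have nonneg: "0 \<le> H x" for x
    by (simp add: H_def)
  have bound: "norm (H x) \<le> norm (indicator D x *\<^sub>R L\<^sup>2)" for x
  proof (cases "x \<in> D - N")
    case True
    then have "norm (grad \<phi> x) \<le> L"
      using D diff lip by (intro norm_grad_le[of D]) auto
    then show ?thesis
      using True by (simp add: H_def power_mono)
  qed (simp add: H_def)
  have fin: "emeasure lborel D < \<infinity>"
    using D emeasure_bounded_finite by blast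
  have "integrable lborel (\<lambda>x. indicator D x *\<^sub>R L\<^sup>2)"
    using fin D by (intro integrable_scaleR_left) (simp add: integrable_indicator_iff)
  then have H_int: "integrable lborel H"
    by (rule Bochner_Integration.integrable_bound) (use Hm bound in auto)
  then have "integrable lebesgue H"
    using Hm by (simp add: integrable_completion)
  moreover have HD: "indicator D x *\<^sub>R H x = H x" for x
    by (simp add: H_def indicator_def)
  ultimately have H_abs: "H absolutely_integrable_on D"
    unfolding set_integrable_def HD by simp
  have eq: "(norm (grad \<phi> x))\<^sup>2 = H x" if "x \<in> D - N" for x
    using that by (simp add: H_def)
  have g_abs: "(\<lambda>x. (norm (grad \<phi> x))\<^sup>2) absolutely_integrable_on D"
    using H_abs N(2) eq by (rule absolutely_integrable_spike)
  have "(LINT x:D|lebesgue. (norm (grad \<phi> x))\<^sup>2) = integral D (\<lambda>x. (norm (grad \<phi> x))\<^sup>2)"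
    using g_abs by (rule set_lebesgue_integral_eq_integral)
  also have "\<dots> = integral D H"
    using N(2) eq by (intro integral_spike[of N]) auto
  also have "\<dots> = (LINT x:D|lebesgue. H x)"
    using H_abs by (rule set_lebesgue_integral_eq_integral(2)[symmetric])
  also have "\<dots> = (\<integral>x. H x \<partial>lborel)"
    using Hm unfolding set_lebesgue_integral_def HD by (simp add: integral_completion)
  finally have "ennreal (LINT x:D|lebesgue. (norm (grad \<phi> x))\<^sup>2) = (\<integral>\<^sup>+x. ennreal (H x) \<partial>lborel)"
    using nn_integral_eq_integral[OF H_int] nonneg by simp
  then show ?thesis
    by (simp add: H_def)
qed

text \<open>The surface element is at least 1, so dropping it removes the slope of the graph from
  the estimate. Continuity on the closed rectangle makes the integrand integrable; otherwise the
  surface integral would be 0 by convention and bound nothing.\<close>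

lemma graph_surface_integral_ge:
  fixes A :: "real ^ 'm \<Rightarrow> real ^ 'n" and M :: "real ^ 'm"
  assumes U: "open U" "cbox 0 M \<subseteq> U" "smooth_on U (\<zeta> \<circ> face_chart a A)"
    and cont: "continuous_on (cbox 0 M) (\<lambda>w. g (overlap_map \<zeta> n (face_chart a A w)))"
    and nonneg: "\<And>x. 0 \<le> g x"
  shows "(\<integral>\<^sup>+w. ennreal (g (overlap_map \<zeta> n (face_chart a A w))) * indicator (box 0 M) w \<partial>lborel)
    \<le> ennreal (graph_surface_integral a A M n \<zeta> g)"
proof -
  define \<gamma> where "\<gamma> w = g (overlap_map \<zeta> n (face_chart a A w))" for w
  define \<sigma> where "\<sigma> w = sqrt (1 + (norm (grad (\<zeta> \<circ> face_chart a A) w))\<^sup>2)" for w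
  have "Ck_on (Suc 0) U (\<zeta> \<circ> face_chart a A)"
    using U(3) by (auto simp: smooth_on_def simp del: Ck_on.simps)
  then have "continuous_on U (\<lambda>w. \<chi> i. grad (\<zeta> \<circ> face_chart a A) w $ i)"
    by (intro continuous_on_vec_lambda) simp
  then have "continuous_on (cbox 0 M) (grad (\<zeta> \<circ> face_chart a A))"
    using continuous_on_subset[OF _ U(2)] by simp
  then have "continuous_on (cbox 0 M) (\<lambda>w. \<gamma> w * \<sigma> w)"
    unfolding \<sigma>_def \<gamma>_def by (intro continuous_intros cont)
  then have "integrable lborel (\<lambda>w. indicator (cbox 0 M) w *\<^sub>R (\<gamma> w * \<sigma> w))"
    by (rule borel_integrable_compact[OF compact_cbox])
  then have "set_integrable lborel (box 0 M) (\<lambda>w. \<gamma> w * \<sigma> w)"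
    unfolding set_integrable_def[symmetric] by (rule set_integrable_subset) (simp_all add: box_subset_cbox)
  then have int: "integrable lborel (\<lambda>w. indicator (box 0 M) w *\<^sub>R (\<gamma> w * \<sigma> w))"
    by (simp add: set_integrable_def)
  have "(\<integral>\<^sup>+w. ennreal (\<gamma> w) * indicator (box 0 M) w \<partial>lborel)
      \<le> (\<integral>\<^sup>+w. ennreal (indicator (box 0 M) w *\<^sub>R (\<gamma> w * \<sigma> w)) \<partial>lborel)"
  proof (rule nn_integral_mono)
    fix w
    have "\<gamma> w * 1 \<le> \<gamma> w * \<sigma> w"
      using nonneg by (intro mult_left_mono) (auto simp: \<sigma>_def \<gamma>_def)
    then show "ennreal (\<gamma> w) * indicator (box 0 M) w \<le> ennreal (indicator (box 0 M) w *\<^sub>R (\<gamma> w * \<sigma> w))"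
      by (auto simp: indicator_def intro: ennreal_leI)
  qed
  also have "\<dots> = ennreal (\<integral>w. indicator (box 0 M) w *\<^sub>R (\<gamma> w * \<sigma> w) \<partial>lborel)"
    using int nonneg by (intro nn_integral_eq_integral) (auto simp: \<gamma>_def \<sigma>_def)
  also have "(\<integral>w. indicator (box 0 M) w *\<^sub>R (\<gamma> w * \<sigma> w) \<partial>lborel) = graph_surface_integral a A M n \<zeta> g"
    unfolding graph_surface_integral_def set_lebesgue_integral_def \<gamma>_def[symmetric] \<sigma>_def[symmetric]
    using borel_measurable_integrable[OF int] by (intro integral_completion[symmetric]) simp
  finally show ?thesis
    by (simp add: \<gamma>_def)
qed

text \<open>If \<open>f\<close> is not integrable over \<open>S\<close>, the left side is 0 by
  convention, so the inequality survives in that case too.\<close>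

lemma ennreal_set_integral_le_nn_integral:
  fixes f :: "'a::euclidean_space \<Rightarrow> real"
  assumes "\<And>x. 0 \<le> f x"
  shows "ennreal (LINT x:S|lebesgue. f x) \<le> (\<integral>\<^sup>+x. ennreal (f x) * indicator S x \<partial>lborel)"
proof (cases "integrable lebesgue (\<lambda>x. indicator S x *\<^sub>R f x)")
  case True
  then have "ennreal (LINT x:S|lebesgue. f x) = (\<integral>\<^sup>+x. ennreal (indicator S x *\<^sub>R f x) \<partial>lebesgue)"
    unfolding set_lebesgue_integral_def using assms by (subst nn_integral_eq_integral) auto
  also have "\<dots> = (\<integral>\<^sup>+x. ennreal (indicator S x *\<^sub>R f x) \<partial>lborel)"
    by (rule nn_integral_completion)
  also have "\<dots> = (\<integral>\<^sup>+x. ennreal (f x) * indicator S x \<partial>lborel)"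
    by (intro nn_integral_cong) (auto simp: indicator_def)
  finally show ?thesis by simp
next
  case False
  then show ?thesis
    by (simp add: set_lebesgue_integral_def not_integrable_integral_eq)
qed

text \<open>The constants are purely numerical: \<open>h\<close>, \<open>C\<close>,
  \<open>lam\<close>, \<open>\<rho>1\<close> and \<open>\<rho>2\<close> enter only afterwards, when
  \<open>d\<close> is compared with \<open>h\<close> and the boundary term receives its
  weight.\<close>

lemma set_integral_overlap_le:
  fixes A :: "real ^ 'm \<Rightarrow> real ^ 'n" and M :: "real ^ 'm"
  assumes card: "CARD('m) + 1 = CARD('n)"
    and \<Omega>: "bounded \<Omega>" and face: "planar_face (interface \<Omega>1 \<Omega>2) a A M n"
    and patches: "overlapping_patches \<Omega> \<Omega>1 \<Omega>2 D1 D2 a A M n \<zeta>"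
    and \<Xi>: "\<forall>i. open_knot_vector p (\<Xi> i)" and param: "bspline_parametrization \<Xi> p \<Phi> D2"
    and \<phi>: "\<phi> \<in> mapped_bspline_space \<Xi> p \<Phi>"
    and d: "d = overlap_width \<zeta> n (overlap_face D1 D2)"
  defines "E \<equiv> (LINT x:D2|lebesgue. (norm (grad \<phi> x))\<^sup>2)"
    and "F \<equiv> graph_surface_integral a A M n \<zeta> (\<lambda>x. (\<phi> x)\<^sup>2)"
  shows "0 \<le> d" "0 \<le> E" "0 \<le> F" "(LINT x:D1 \<inter> D2|lebesgue. (\<phi> x)\<^sup>2) \<le> 2 * d * F + 2 * d\<^sup>2 * E"
proof -
  have frame: "hyperplane_frame A n" and M: "\<And>i. 0 < M $ i" and int: "interface \<Omega>1 \<Omega>2 = face_chart a A ` cbox 0 M"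
    using face by (auto simp: planar_face_def)
  have lin: "linear A" and n: "norm n = 1"
    using frame by (auto simp: hyperplane_frame_def)
  have D: "open D1" "open D2" and cl: "closure \<Omega> = closure D1 \<union> closure D2" and sub: "D1 \<inter> D2 \<subseteq> \<Omega>"
    and F12: "overlap_face D1 D2 = rel_interior (interface \<Omega>1 \<Omega>2)"
    and F21: "overlap_face D2 D1 = overlap_map \<zeta> n ` overlap_face D1 D2"
    and front: "frontier (D1 \<inter> D2) = closure (overlap_face D1 D2 \<union> overlap_face D2 D1)"
    using patches unfolding overlapping_patches_def by blast+
  obtain U where U: "open U" "cbox 0 M \<subseteq> U" "smooth_on U (\<zeta> \<circ> face_chart a A)"
    using patches unfolding overlapping_patches_def by blast
  define z where "z w = \<zeta> (a + A w)" for w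
  have chart: "face_chart a A w = a + A w" "overlap_map \<zeta> n (face_chart a A w) = a + A w + z w *\<^sub>R n" for w
    by (simp_all add: face_chart_def overlap_map_def z_def)
  have F12': "overlap_face D1 D2 = (\<lambda>w. a + A w) ` box 0 M"
    unfolding F12 int rel_interior_face_chart[OF frame M] by (simp add: face_chart_def)
  have F21': "overlap_face D2 D1 = (\<lambda>w. a + A w + z w *\<^sub>R n) ` box 0 M"
    unfolding F21 F12' image_image by (simp add: overlap_map_def z_def)
  have ne: "box 0 M \<noteq> {}"
    using M by (auto simp: box_ne_empty Basis_vec_def inner_axis)
  have "Ck_on 0 U (\<zeta> \<circ> face_chart a A)"
    using U(3) by (simp only: smooth_on_def)
  then have contz: "continuous_on (cbox 0 M) z"
    using continuous_on_subset[OF _ U(2)] by (simp add: o_def z_def[abs_def] face_chart_def)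
  have contA: "continuous_on (cbox 0 M) (\<lambda>w. a + A w)"
    by (intro continuous_intros linear_continuous_on_compose[OF _ lin])
  have contG: "continuous_on (cbox 0 M) (\<lambda>w. a + A w + z w *\<^sub>R n)"
    by (intro continuous_intros contA contz)
  \<comment> \<open>The images of the closed rectangle are compact, so the edges added by the
    closure stay inside them.\<close>
  have "closure (overlap_face D1 D2 \<union> overlap_face D2 D1)
      \<subseteq> (\<lambda>w. a + A w) ` cbox 0 M \<union> (\<lambda>w. a + A w + z w *\<^sub>R n) ` cbox 0 M"
    unfolding F12' F21'
    by (intro closure_minimal closed_Un compact_imp_closed compact_continuous_image contA contG compact_cbox
        Un_mono image_mono box_subset_cbox)
  then have front': "frontier (D1 \<inter> D2) \<subseteq> (\<lambda>w. a + A w) ` cbox 0 M \<union> (\<lambda>w. a + A w + z w *\<^sub>R n) ` cbox 0 M"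
    by (simp only: front)
  have in12: "a + A w \<in> frontier D1" and in21: "a + A w + z w *\<^sub>R n \<in> frontier D2" if "w \<in> box 0 M" for w
  proof -
    have "a + A w \<in> overlap_face D1 D2" "a + A w + z w *\<^sub>R n \<in> overlap_face D2 D1"
      unfolding F12' F21' using that by blast+
    then show "a + A w \<in> frontier D1" "a + A w + z w *\<^sub>R n \<in> frontier D2"
      by (simp_all add: overlap_face_def)
  qed
  have off: "\<forall>w\<in>box 0 M. a + A w \<notin> D1 \<inter> D2 \<and> a + A w + z w *\<^sub>R n \<notin> D1 \<inter> D2"
    using in12 in21 D by (simp add: frontier_def interior_open)
  have d': "d = (SUP w\<in>box 0 M. \<bar>z w\<bar>)"
    unfolding d overlap_width_def F12' image_image using n by (simp add: overlap_map_def z_def)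
  \<comment> \<open>The width is a supremum over the open rectangle. It bounds the heights only if
    these are bounded above, which compactness of the closed rectangle provides.\<close>
  have "bounded (z ` cbox 0 M)"
    by (intro compact_imp_bounded compact_continuous_image contz compact_cbox)
  then obtain b where "\<And>w. w \<in> cbox 0 M \<Longrightarrow> \<bar>z w\<bar> \<le> b"
    unfolding bounded_iff by (metis imageI real_norm_def)
  then have "bdd_above ((\<lambda>w. \<bar>z w\<bar>) ` box 0 M)"
    using box_subset_cbox[of 0 M] by (intro bdd_aboveI2[of _ _ b]) blast
  then have zd: "\<bar>z w\<bar> \<le> d" if "w \<in> box 0 M" for w
    unfolding d' using that by (rule_tac cSUP_upper)
  show d0: "0 \<le> d"
    using ne zd by (meson abs_ge_zero ex_in_conv order_trans)
  have D2b: "bounded D2"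
  proof (rule bounded_subset[OF bounded_closure[OF \<Omega>]])
    show "D2 \<subseteq> closure \<Omega>" using cl closure_subset by blast
  qed
  obtain L N where reg: "compact N" "negligible N" "continuous_on (closure D2) \<phi>" "0 \<le> L"
    "\<And>x y. closed_segment x y \<subseteq> D2 \<Longrightarrow> \<bar>\<phi> x - \<phi> y\<bar> \<le> L * dist x y"
    "\<And>x. x \<in> D2 - N \<Longrightarrow> \<phi> differentiable (at x)"
    using mapped_bspline_regularity[OF \<Xi> param D(2) \<phi>] by metis
  \<comment> \<open>Over the edges the graph points are limits of points of
    \<open>overlap_face D2 D1\<close>. The trace of \<open>\<phi>\<close> is thus continuous on the
    closed rectangle, as integrability over the graph requires.\<close>
  have graph_cl: "a + A w + z w *\<^sub>R n \<in> closure D2" if "w \<in> cbox 0 M" for w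
  proof -
    have "(\<lambda>w. a + A w + z w *\<^sub>R n) ` closure (box 0 M) \<subseteq> closure D2"
    proof (rule image_closure_subset[OF _ closed_closure])
      show "continuous_on (closure (box 0 M)) (\<lambda>w. a + A w + z w *\<^sub>R n)"
        using contG ne by (simp add: closure_box)
      show "(\<lambda>w. a + A w + z w *\<^sub>R n) ` box 0 M \<subseteq> closure D2"
        using in21 by (auto simp: frontier_def)
    qed
    then show ?thesis
      using that ne by (auto simp: closure_box)
  qed
  have main: "(\<integral>\<^sup>+x. ennreal ((\<phi> x)\<^sup>2) * indicator (D1 \<inter> D2) x \<partial>lborel) \<le>
     ennreal (2 * d) * (\<integral>\<^sup>+w. ennreal ((\<phi> (a + A w + z w *\<^sub>R n))\<^sup>2) * indicator (box 0 M) w \<partial>lborel)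
     + ennreal (2 * d\<^sup>2) * (\<integral>\<^sup>+x. ennreal ((norm (indicator (D2 - N) x *\<^sub>R grad \<phi> x))\<^sup>2) \<partial>lborel)"
  proof (rule nn_integral_region_between_graphs_le[OF frame card _ _ _ front' off _ zd _ D(2) reg(3,4,5,1,2,6) d0])
    show "open (D1 \<inter> D2)" "D1 \<inter> D2 \<subseteq> D2" using D by auto
    show "bounded (D1 \<inter> D2)" using \<Omega> sub by (rule bounded_subset)
    show "continuous_on (box 0 M) z"
      using contz box_subset_cbox by (rule continuous_on_subset)
    show "a + A w + z w *\<^sub>R n \<in> closure D2" if "w \<in> box 0 M" for w
      using graph_cl that box_subset_cbox by blast
  qed
  have E: "(\<integral>\<^sup>+x. ennreal ((norm (indicator (D2 - N) x *\<^sub>R grad \<phi> x))\<^sup>2) \<partial>lborel) = ennreal E"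
    unfolding E_def
    by (rule square_grad_integral[OF D(2) D2b continuous_on_subset[OF reg(3) closure_subset] reg(5)
          compact_imp_closed[OF reg(1)] reg(2,6)])
  have F: "(\<integral>\<^sup>+w. ennreal ((\<phi> (a + A w + z w *\<^sub>R n))\<^sup>2) * indicator (box 0 M) w \<partial>lborel) \<le> ennreal F"
    unfolding F_def chart(2)[symmetric]
  proof (rule graph_surface_integral_ge[OF U])
    have "continuous_on (cbox 0 M) (\<lambda>w. \<phi> (a + A w + z w *\<^sub>R n))"
      by (rule continuous_on_compose2[OF reg(3) contG]) (use graph_cl in blast)
    then show "continuous_on (cbox 0 M) (\<lambda>w. (\<phi> (overlap_map \<zeta> n (face_chart a A w)))\<^sup>2)"
      unfolding chart(2) by (intro continuous_intros)
  qed simp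
  show E0: "0 \<le> E" and F0: "0 \<le> F"
    unfolding E_def F_def graph_surface_integral_def set_lebesgue_integral_def
    by (intro integral_nonneg_AE AE_I2; simp)+
  have "ennreal (LINT x:D1 \<inter> D2|lebesgue. (\<phi> x)\<^sup>2) \<le> (\<integral>\<^sup>+x. ennreal ((\<phi> x)\<^sup>2) * indicator (D1 \<inter> D2) x \<partial>lborel)"
    by (rule ennreal_set_integral_le_nn_integral) simp
  also note main
  also have "ennreal (2 * d) * (\<integral>\<^sup>+w. ennreal ((\<phi> (a + A w + z w *\<^sub>R n))\<^sup>2) * indicator (box 0 M) w \<partial>lborel)
     + ennreal (2 * d\<^sup>2) * (\<integral>\<^sup>+x. ennreal ((norm (indicator (D2 - N) x *\<^sub>R grad \<phi> x))\<^sup>2) \<partial>lborel)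
     \<le> ennreal (2 * d) * ennreal F + ennreal (2 * d\<^sup>2) * ennreal E"
    unfolding E by (intro add_mono mult_left_mono F) auto
  also have "\<dots> = ennreal (2 * d * F + 2 * d\<^sup>2 * E)"
    using d0 E0 F0 by (simp add: ennreal_mult ennreal_plus)
  finally show "(LINT x:D1 \<inter> D2|lebesgue. (\<phi> x)\<^sup>2) \<le> 2 * d * F + 2 * d\<^sup>2 * E"
    using d0 E0 F0 by (subst (asm) ennreal_le_iff) auto
qed

theorem proposition1:
  fixes \<Omega> \<Omega>1 \<Omega>2 :: "(real ^ 'n) set"
    and \<rho> :: "real ^ 'n \<Rightarrow> real"
    and \<rho>1 \<rho>2 C lam :: real
    and p :: nat
    and a n :: "real ^ 'n"
    and A :: "real ^ 'm \<Rightarrow> real ^ 'n"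
    and M :: "real ^ 'm"
  assumes "CARD('n) \<in> {2, 3}"
    and "CARD('m) + 1 = CARD('n)"
    and "bounded_lipschitz_domain \<Omega>"
    and "subdomain \<Omega>1 \<Omega>" and "subdomain \<Omega>2 \<Omega>" and "\<Omega>1 \<inter> \<Omega>2 = {}"
    and "closure \<Omega> = closure \<Omega>1 \<union> closure \<Omega>2"
    and "\<rho>1 > 0" and "\<rho>2 > 0"
    and "\<forall>x\<in>\<Omega>1. \<rho> x = \<rho>1" and "\<forall>x\<in>\<Omega>2. \<rho> x = \<rho>2"
    and "planar_face (interface \<Omega>1 \<Omega>2) a A M n"
    and "C > 0" and "lam \<ge> 1"
  shows "\<exists>c>0. \<forall>f u D1 D2 \<zeta> \<Xi>1 \<Xi>2 \<Phi>2 h d\<^sub>o \<phi>.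
      weak_solution \<Omega> \<rho> f u \<longrightarrow>
      overlapping_patches \<Omega> \<Omega>1 \<Omega>2 D1 D2 a A M n \<zeta> \<longrightarrow>
      (\<forall>i. open_knot_vector p (\<Xi>1 i)) \<longrightarrow>
      (\<forall>i. open_knot_vector p (\<Xi>2 i)) \<longrightarrow>
      bspline_parametrization \<Xi>2 p \<Phi>2 D2 \<longrightarrow>
      h = max (mesh_size (\<Xi>1 :: 'n \<Rightarrow> real list)) (mesh_size \<Xi>2) \<longrightarrow>
      d\<^sub>o = overlap_width \<zeta> n (overlap_face D1 D2) \<longrightarrow>
      d\<^sub>o \<le> C * h powr lam \<longrightarrow>
      \<phi> \<in> mapped_bspline_space \<Xi>2 p \<Phi>2 \<longrightarrow>
      (LINT x:D1 \<inter> D2|lebesgue. (\<phi> x)\<^sup>2)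
        \<le> c * d\<^sub>o * h *
          ((LINT x:D2|lebesgue. (norm (grad \<phi> x))\<^sup>2)
           + ((\<rho>1 + \<rho>2) / 2) / h *
             graph_surface_integral a A M n \<zeta> (\<lambda>x. (\<phi> x)\<^sup>2))"
proof (intro exI conjI allI impI)
  \<comment> \<open>\<open>K\<close> bounds \<open>h powr (lam - 1)\<close>, because
    \<open>lam \<ge> 1\<close> and \<open>h\<close> is at most the diagonal of the unit
    cube.\<close>
  define K where "K = norm (1 :: real ^ 'n) powr (lam - 1)"
  define \<rho>m where "\<rho>m = (\<rho>1 + \<rho>2) / 2"
  have K: "0 \<le> K" and \<rho>m: "0 < \<rho>m"
    using assms by (auto simp: K_def \<rho>m_def)
  \<comment> \<open>The summand \<open>2 * C * K\<close> pays for the gradient term via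
    \<open>2 * d \<le> 2 * C * K * h\<close>, and \<open>2 / \<rho>m\<close> pays for the boundary
    term via \<open>2 \<le> c * \<rho>m\<close>. Both are fixed before the overlap, the knots and
    the spline.\<close>
  define c where "c = 2 * C * K + 2 / \<rho>m"
  show "0 < c"
    using K \<rho>m \<open>C > 0\<close> by (auto simp: c_def intro: add_nonneg_pos)
  fix f u D1 D2 \<zeta> \<Xi>1 and \<Xi>2 :: "'n \<Rightarrow> real list" and \<Phi>2 h d \<phi>
  assume patches: "overlapping_patches \<Omega> \<Omega>1 \<Omega>2 D1 D2 a A M n \<zeta>"
    and \<Xi>1: "\<forall>i. open_knot_vector p (\<Xi>1 i)" and \<Xi>2: "\<forall>i. open_knot_vector p (\<Xi>2 i)"
    and param: "bspline_parametrization \<Xi>2 p \<Phi>2 D2"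
    and h: "h = max (mesh_size (\<Xi>1 :: 'n \<Rightarrow> real list)) (mesh_size \<Xi>2)"
    and d: "d = overlap_width \<zeta> n (overlap_face D1 D2)" and d_le: "d \<le> C * h powr lam"
    and \<phi>: "\<phi> \<in> mapped_bspline_space \<Xi>2 p \<Phi>2"
  let ?E = "LINT x:D2|lebesgue. (norm (grad \<phi> x))\<^sup>2"
  let ?F = "graph_surface_integral a A M n \<zeta> (\<lambda>x. (\<phi> x)\<^sup>2)"
  have "bounded \<Omega>"
    using assms(3) by (simp add: bounded_lipschitz_domain_def)
  note est = set_integral_overlap_le[OF assms(2) this assms(12) patches \<Xi>2 param \<phi> d]
  have h0: "0 < h" and h1: "h \<le> norm (1 :: real ^ 'n)"
    using mesh_size_bounds[OF \<Xi>1] mesh_size_bounds[OF \<Xi>2] by (auto simp: h)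
  have "h powr lam = h * h powr (lam - 1)"
    using h0 powr_add[of h 1 "lam - 1"] by simp
  also have "\<dots> \<le> h * K"
    unfolding K_def using h0 h1 \<open>lam \<ge> 1\<close> by (intro mult_left_mono powr_mono2) auto
  finally have "C * h powr lam \<le> C * (h * K)"
    using \<open>C > 0\<close> by (intro mult_left_mono) auto
  then have "2 * d \<le> (2 * C * K) * h"
    using d_le by (simp add: mult_ac)
  also have "\<dots> \<le> c * h"
    using h0 \<rho>m by (intro mult_right_mono) (auto simp: c_def)
  finally have "d * ?E * (2 * d) \<le> d * ?E * (c * h)"
    using est(1,2) by (intro mult_left_mono) auto
  moreover have "2 \<le> c * \<rho>m"
    using \<rho>m K \<open>C > 0\<close> by (simp add: c_def distrib_right)
  then have "d * ?F * 2 \<le> d * ?F * (c * \<rho>m)"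
    using est(1,3) by (intro mult_left_mono) auto
  \<comment> \<open>In the boundary term \<open>h\<close> cancels against \<open>1 / h\<close>, so
    no comparison of \<open>d\<close> with \<open>h\<close> is used there.\<close>
  moreover have "c * d * h * (?E + \<rho>m / h * ?F) = d * ?E * (c * h) + d * ?F * (c * \<rho>m)"
    using h0 by (simp add: field_simps)
  ultimately have "2 * d * ?F + 2 * d\<^sup>2 * ?E \<le> c * d * h * (?E + \<rho>m / h * ?F)"
    by (simp add: power2_eq_square mult_ac)
  then show "(LINT x:D1 \<inter> D2|lebesgue. (\<phi> x)\<^sup>2) \<le> c * d * h * (?E + ((\<rho>1 + \<rho>2) / 2) / h * ?F)"
    using est(4) unfolding \<rho>m_def by (rule order_trans[rotated])
qed

end
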